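(* Let $\zeta$ be an ordinal with a system of fundamental sequences $(\xi\lceil n\rceil)_{n\in\omega}$, $\xi\le\zeta$. If this system is nested, then the system of fundamental sequences on $\Gamma_\zeta$ defined by rules (1)–(7) below is nested.
   Context: A fundamental sequence for an ordinal $\alpha>0$ is a non-decreasing sequence $(\alpha[n])_{n\in\omega}$ of ordinals with $\sup_n(\alpha[n]+1)=\alpha$; by convention $0[n]=0$. A system of fundamental sequences on $\Gamma$ fixes one for each $\alpha\le\Gamma$. It is nested if there are never $\gamma<\beta\le\Gamma$ and $n>1$ with $\gamma>\beta[n]>\gamma[n]$. Veblen functions: $\varphi_0(\beta)=\omega^\beta$, and for $\delta>0$, $\varphi_\delta$ enumerates the common fixed points of all $\varphi_{\delta'}$, $\delta'<\delta$; $\varphi_\delta^{m}$ is the $m$-fold iterate. $\Gamma_\xi$ is the $\xi$-th (from $0$) ordinal $\lambda$ with $\varphi_\lambda(0)=\lambda$. Let $h(x)=\varphi_x(0)$. The system on $\Gamma_\zeta$ is: (1) if $\alpha=\alpha_0+\omega^{\alpha_1}$ with $\alpha_0>0$ and the last exponent in the Cantor normal form of $\alpha_0$ at least $\alpha_1$, then $\alpha[n]=\alpha_0+(\omega^{\alpha_1}[n])$; (2) $0[n]=0$, $1[n]=0$; (3) if $0<\alpha<\omega^\alpha$ then $\omega^\alpha[n]=\omega^{\alpha[n]}\cdot n$; (4) if $0<\delta<\varphi_\delta(0)$ then $\varphi_\delta(0)[n]=\varphi^{n+1}_{\delta[n]}(0)$; (5) if $0<\alpha<\varphi_\delta(\alpha)$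 and $0<\delta$ then $\varphi_\delta(\alpha)[n]=\varphi^{n+1}_{\delta[n]}(\varphi_\delta(\alpha[n])+1)$; (6) $\Gamma_0[n]=h^{n+1}(0)$ (i.e. $\varphi_{\varphi_{\cdot^{\cdot}\varphi_0(0)}(0)}(0)$ with $\varphi$ occurring $n+1$ times); (7) if $0<\xi\le\zeta$ then $\Gamma_\xi[n]=h^{n+1}(\Gamma_{\xi\lceil n\rceil}+1)$ (i.e. $\varphi_{\varphi_{\cdot^{\cdot}\varphi_{\Gamma_{\xi\lceil n\rceil}+1}(0)}(0)}(0)$ with $\varphi$ occurring $n+1$ times). *)

theory Defs
  imports Main
begin

(* Ordinals are isomorphism classes of well-orders on subsets of the infinite type nat + 'a.
   Hence 'a ordinal is (order-isomorphic to) the successor cardinal of |nat + 'a|, which is a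
   regular uncountable cardinal, closed under all the operations below; and every well-order
   of HOL is represented in 'a ordinal for a suitable 'a. *)

quotient_type 'a ordinal = "(nat + 'a) rel" / partial: "\<lambda>r s. (r, s) \<in> ordIso"
proof (rule part_equivpI)
  show "\<exists>r :: (nat + 'a) rel. (r, r) \<in> ordIso"
    using ordIso_reflexive well_order_on_empty Field_empty by metis
  show "symp (\<lambda>r s :: (nat + 'a) rel. (r, s) \<in> ordIso)"
    by (rule sympI) (rule ordIso_symmetric)
  show "transp (\<lambda>r s :: (nat + 'a) rel. (r, s) \<in> ordIso)"
    by (rule transpI) (rule ordIso_transitive)
qed

lemma ordIso_ordLeq_cong:
  assumes "(r, r') \<in> ordIso" "(s, s') \<in> ordIso"
  shows "(r, s) \<in> ordLeq \<longleftrightarrow> (r', s') \<in> ordLeq"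
  by (meson assms ordIso_ordLeq_trans ordIso_symmetric ordLeq_ordIso_trans)

lemma ordIso_ordLess_cong:
  assumes "(r, r') \<in> ordIso" "(s, s') \<in> ordIso"
  shows "(r, s) \<in> ordLess \<longleftrightarrow> (r', s') \<in> ordLess"
  by (meson assms ordIso_ordLess_trans ordIso_symmetric ordLess_ordIso_trans)

lemma ordIso_selfD: "(r, r) \<in> ordIso \<Longrightarrow> Well_order r"
  by (simp add: ordIso_def)

instantiation ordinal :: (type) wellorder
begin

lift_definition less_eq_ordinal :: "'a ordinal \<Rightarrow> 'a ordinal \<Rightarrow> bool"
  is "\<lambda>r s. (r, s) \<in> ordLeq"
  by (rule ordIso_ordLeq_cong)

lift_definition less_ordinal :: "'a ordinal \<Rightarrow> 'a ordinal \<Rightarrow> bool"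
  is "\<lambda>r s. (r, s) \<in> ordLess"
  by (rule ordIso_ordLess_cong)

lemma wf_less_ordinal: "wf {(x, y). x < (y :: 'a ordinal)}"
proof -
  have "{(x, y). x < (y :: 'a ordinal)} \<subseteq> inv_image ordLess rep_ordinal"
    by (auto simp: less_ordinal.rep_eq)
  then show ?thesis
    using wf_inv_image[OF wf_ordLess] wf_subset by blast
qed

instance
proof
  fix x y z :: "'a ordinal"
  show "x < y \<longleftrightarrow> x \<le> y \<and> \<not> y \<le> x"
    by transfer (meson ordIso_selfD not_ordLess_iff_ordLeq not_ordLeq_iff_ordLess ordLess_imp_ordLeq)
  show "x \<le> x"
    by transfer (simp add: ordIso_iff_ordLeq)
  show "x \<le> y \<Longrightarrow> y \<le> z \<Longrightarrow> x \<le> z"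
    by transfer (rule ordLeq_transitive)
  show "x \<le> y \<Longrightarrow> y \<le> x \<Longrightarrow> x = y"
    by transfer (simp add: ordIso_iff_ordLeq)
  show "x \<le> y \<or> y \<le> x"
    by transfer (meson ordIso_selfD ordLeq_total)
next
  fix P :: "'a ordinal \<Rightarrow> bool" and a :: "'a ordinal"
  assume "\<And>x. (\<And>y. y < x \<Longrightarrow> P y) \<Longrightarrow> P x"
  then show "P a"
    using wf_induct_rule[OF wf_less_ordinal, of P a] by auto
qed

end

definition osup :: "'a ordinal set \<Rightarrow> 'a ordinal" where
  "osup S = (LEAST \<beta>. \<forall>\<alpha>\<in>S. \<alpha> \<le> \<beta>)"

definition osucc :: "'a ordinal \<Rightarrow> 'a ordinal" where
  "osucc \<alpha> = (LEAST \<beta>. \<alpha> < \<beta>)"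

instantiation ordinal :: (type) "{zero, one, plus, times}"
begin

definition zero_ordinal :: "'a ordinal" where
  "0 = (LEAST \<alpha> :: 'a ordinal. True)"

definition one_ordinal :: "'a ordinal" where
  "1 = osucc (0 :: 'a ordinal)"

function plus_ordinal :: "'a ordinal \<Rightarrow> 'a ordinal \<Rightarrow> 'a ordinal" where
  "\<alpha> + \<beta> = osup (insert \<alpha> ((\<lambda>\<eta>. osucc (\<alpha> + \<eta>)) ` {..<\<beta>}))" for \<alpha> \<beta> :: "'a ordinal"
  by pat_completeness auto
termination
  by (relation "inv_image {(x, y). x < y} snd", rule wf_inv_image[OF wf_less_ordinal]) simp

declare plus_ordinal.simps [simp del]

function times_ordinal :: "'a ordinal \<Rightarrow> 'a ordinal \<Rightarrow> 'a ordinal" where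
  "\<alpha> * \<beta> = osup ((\<lambda>\<eta>. \<alpha> * \<eta> + \<alpha>) ` {..<\<beta>})" for \<alpha> \<beta> :: "'a ordinal"
  by pat_completeness auto
termination
  by (relation "inv_image {(x, y). x < y} snd", rule wf_inv_image[OF wf_less_ordinal]) simp

declare times_ordinal.simps [simp del]

instance ..

end

primrec ord_of_nat :: "nat \<Rightarrow> 'a ordinal" where
  "ord_of_nat 0 = 0"
| "ord_of_nat (Suc n) = ord_of_nat n + 1"

definition omega :: "'a ordinal" where
  "omega = osup (range ord_of_nat)"

function omega_pow :: "'a ordinal \<Rightarrow> 'a ordinal" where
  "omega_pow \<beta> = osup (insert 1 ((\<lambda>\<eta>. omega_pow \<eta> * omega) ` {..<\<beta>}))"
  by pat_completeness auto
termination
  by (relation "{(x, y). x < y}", rule wf_less_ordinal) simp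

declare omega_pow.simps [simp del]

(* enum S \<xi> is the \<xi>-th element, counting from 0, of S in increasing order. *)
function enum :: "'a ordinal set \<Rightarrow> 'a ordinal \<Rightarrow> 'a ordinal" where
  "enum S \<xi> = (LEAST \<alpha>. \<alpha> \<in> S \<and> (\<forall>\<eta>\<in>{..<\<xi>}. enum S \<eta> < \<alpha>))"
  by pat_completeness auto
termination
  by (relation "inv_image {(x, y). x < y} snd", rule wf_inv_image[OF wf_less_ordinal]) simp

declare enum.simps [simp del]

function veblen :: "'a ordinal \<Rightarrow> 'a ordinal \<Rightarrow> 'a ordinal" where
  "veblen \<delta> =
    (if \<delta> = 0 then omega_pow
     else enum {\<alpha>. \<forall>\<delta>'\<in>{..<\<delta>}. veblen \<delta>' \<alpha> = \<alpha>})"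
  by pat_completeness auto
termination
  by (relation "{(x, y). x < y}", rule wf_less_ordinal) simp

declare veblen.simps [simp del]

definition Gamma :: "'a ordinal \<Rightarrow> 'a ordinal" where
  "Gamma = enum {\<alpha>. veblen \<alpha> 0 = \<alpha>}"

definition fundamental_sequence :: "'a ordinal \<Rightarrow> (nat \<Rightarrow> 'a ordinal) \<Rightarrow> bool" where
  "fundamental_sequence \<alpha> s \<longleftrightarrow> mono s \<and> osup (range (\<lambda>n. s n + 1)) = \<alpha>"

definition fundamental_system :: "'a ordinal \<Rightarrow> ('a ordinal \<Rightarrow> nat \<Rightarrow> 'a ordinal) \<Rightarrow> bool" where
  "fundamental_system \<Gamma> F \<longleftrightarrow>
    (\<forall>n. F 0 n = 0) \<and> (\<forall>\<alpha>\<le>\<Gamma>. 0 < \<alpha> \<longrightarrow> fundamental_sequence \<alpha> (F \<alpha>))"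

definition nested :: "'a ordinal \<Rightarrow> ('a ordinal \<Rightarrow> nat \<Rightarrow> 'a ordinal) \<Rightarrow> bool" where
  "nested \<Gamma> F \<longleftrightarrow>
    \<not> (\<exists>\<gamma> \<beta> n. \<gamma> < \<beta> \<and> \<beta> \<le> \<Gamma> \<and> 1 < n \<and> F \<beta> n < \<gamma> \<and> F \<gamma> n < F \<beta> n)"

(* The list of exponents of the Cantor normal form, greatest exponent first. *)
definition cantor_normal_form :: "'a ordinal list \<Rightarrow> 'a ordinal \<Rightarrow> bool" where
  "cantor_normal_form es \<alpha> \<longleftrightarrow>
    sorted_wrt (\<ge>) es \<and> \<alpha> = foldr (\<lambda>e \<sigma>. omega_pow e + \<sigma>) es 0"

(* gamma_val \<zeta> X \<alpha> n \<beta> says that the rules yield the value \<alpha>[n] = \<beta>; here X \<xi> n is the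
   n-th element of the given fundamental sequence for \<xi> \<le> \<zeta>. *)
inductive gamma_val ::
  "'a ordinal \<Rightarrow> ('a ordinal \<Rightarrow> nat \<Rightarrow> 'a ordinal) \<Rightarrow> 'a ordinal \<Rightarrow> nat \<Rightarrow> 'a ordinal \<Rightarrow> bool"
  for \<zeta> X where
  sum: "\<lbrakk> 0 < \<alpha>\<^sub>0; cantor_normal_form es \<alpha>\<^sub>0; \<alpha>\<^sub>1 \<le> last es; gamma_val \<zeta> X (omega_pow \<alpha>\<^sub>1) n \<beta> \<rbrakk>
    \<Longrightarrow> gamma_val \<zeta> X (\<alpha>\<^sub>0 + omega_pow \<alpha>\<^sub>1) n (\<alpha>\<^sub>0 + \<beta>)"
| zero: "gamma_val \<zeta> X 0 n 0"
| one: "gamma_val \<zeta> X 1 n 0"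
| omega_pow: "\<lbrakk> 0 < \<alpha>; \<alpha> < omega_pow \<alpha>; gamma_val \<zeta> X \<alpha> n \<beta> \<rbrakk>
    \<Longrightarrow> gamma_val \<zeta> X (omega_pow \<alpha>) n (omega_pow \<beta> * ord_of_nat n)"
| veblen_zero: "\<lbrakk> 0 < \<delta>; \<delta> < veblen \<delta> 0; gamma_val \<zeta> X \<delta> n \<eta> \<rbrakk>
    \<Longrightarrow> gamma_val \<zeta> X (veblen \<delta> 0) n ((veblen \<eta> ^^ (n + 1)) 0)"
| veblen: "\<lbrakk> 0 < \<alpha>; \<alpha> < veblen \<delta> \<alpha>; 0 < \<delta>; gamma_val \<zeta> X \<delta> n \<eta>; gamma_val \<zeta> X \<alpha> n \<beta> \<rbrakk>
    \<Longrightarrow> gamma_val \<zeta> X (veblen \<delta> \<alpha>) n ((veblen \<eta> ^^ (n + 1)) (veblen \<delta> \<beta> + 1))"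
| Gamma_zero: "gamma_val \<zeta> X (Gamma 0) n (((\<lambda>x. veblen x 0) ^^ (n + 1)) 0)"
| Gamma: "\<lbrakk> 0 < \<xi>; \<xi> \<le> \<zeta> \<rbrakk>
    \<Longrightarrow> gamma_val \<zeta> X (Gamma \<xi>) n (((\<lambda>x. veblen x 0) ^^ (n + 1)) (Gamma (X \<xi> n) + 1))"

definition gamma_system ::
  "'a ordinal \<Rightarrow> ('a ordinal \<Rightarrow> nat \<Rightarrow> 'a ordinal) \<Rightarrow> 'a ordinal \<Rightarrow> nat \<Rightarrow> 'a ordinal" where
  "gamma_system \<zeta> X \<alpha> n = (THE \<beta>. gamma_val \<zeta> X \<alpha> n \<beta>)"

end

theory Submission
  imports Defs
begin

text \<open>
  The nestedness of the new system is proved by induction on \<open>\<beta>\<close>, comparing the shapes of \<open>\<beta>\<close>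
  and of an ordinal \<open>\<gamma>\<close> with \<open>\<beta>[n] < \<gamma> < \<beta>\<close>. If \<open>\<beta>\<close> has the shape \<open>\<phi>\<^sub>\<delta>(\<alpha>)\<close>, then \<open>\<beta>[n]\<close> is an iterate of
  \<open>f = \<phi>\<close> with index \<open>\<delta>[n]\<close>, started at \<open>0\<close> or just above a fixed point of \<open>f\<close>. An ordinal
  \<open>\<gamma>\<close> above such a start \<open>b\<close> that is not a fixed point of \<open>f\<close> satisfies \<open>b \<le> \<gamma>[n]\<close>, and this property of
  \<open>b\<close> is inherited by \<open>f b\<close>, hence by \<open>\<beta>[n]\<close>. If \<open>\<gamma>\<close> is a fixed point of \<open>f\<close>, it is itself a value
  \<open>\<phi>\<^sub>\<mu>(\<eta>)\<close> with \<open>\<mu> > \<delta>[n]\<close>, and the induction hypothesis applies to \<open>\<mu> < \<delta>\<close> or to \<open>\<eta> < \<alpha>\<close>. The case of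
  \<open>\<beta> = \<Gamma>\<^sub>\<xi>\<close> is similar with \<open>h\<close> in place of \<open>f\<close>, and reduces to the nestedness of the given system
  when \<open>\<gamma>\<close> is some \<open>\<Gamma>\<^sub>\<theta>\<close>.
\<close>

section \<open>Small sets of ordinals and addition\<close>

unbundle cardinal_syntax

text \<open>The restriction to ordinals that \<open>f\<close> does not fix is forced. With
  \<open>f = veblen \<mu>\<close>, the fixed point \<open>veblen (\<mu> + 1) 0\<close> has the
  (n+1)-fold iterate of \<open>f\<close> at 0 as its n-th member, while the (n+2)-fold iterate lies
  strictly between the two. So no bound that survives arbitrary applications of \<open>f\<close> can
  hold for fixed points as well, and these need the induction. The start
  \<open>veblen \<delta> (\<alpha>[n]) + 1\<close> carries its successor because
  \<open>veblen \<delta> (\<alpha>[n])\<close> is fixed by every Veblen function of smaller index,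
  so that an iteration from there would stand still. The successor is paid for by n > 1: if x is a
  fixed point of \<open>omega_pow\<close>, then the n-th member of \<open>omega_pow (x + 1)\<close>
  is the n-fold multiple of x, which reaches x + 1 only from n = 2 on. Ordinal arithmetic is built
  here from the recursive definitions. Suprema and unbounded classes of fixed points exist in the
  type only because small sets of ordinals are bounded, which is therefore settled before anything
  else.\<close>

text \<open>Prepares a Burali-Forti argument: an injection of the ordinals into
  \<open>nat + 'a\<close> would turn each set of ordinals into a well-order on a subset of that
  carrier, hence into an element of \<open>'a ordinal\<close>.\<close>

definition transported_order :: "('b::wellorder \<Rightarrow> 'c) \<Rightarrow> 'b set \<Rightarrow> 'c rel" where
  "transported_order g D = {(g x, g y) | x y. x \<le> y \<and> x \<in> D \<and> y \<in> D}"

lemma Field_transported_order: "Field (transported_order g D) = g ` D"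
  by (auto simp: transported_order_def Field_def)

lemma Well_order_transported_order:
  fixes g :: "'b::wellorder \<Rightarrow> 'c"
  assumes "inj g"
  shows "Well_order (transported_order g D)"
proof -
  let ?r = "transported_order g D"
  have "refl_on (Field ?r) ?r"
    unfolding Field_transported_order by (auto simp: refl_on_def transported_order_def)
  moreover have "trans ?r"
    by (rule transI) (auto simp: transported_order_def inj_eq[OF assms] intro: order_trans)
  moreover have "antisym ?r"
    by (rule antisymI) (auto simp: transported_order_def inj_eq[OF assms])
  moreover have "total_on (Field ?r) ?r"
    unfolding Field_transported_order by (auto simp: total_on_def transported_order_def; metis linear)
  moreover have "?r \<subseteq> Field ?r \<times> Field ?r"
    by (auto simp: Field_def)
  moreover have "wf (?r - Id)"
  proof -
    have "wf {(x, y). x < (y :: 'b)}"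
      by (rule wf)
    then have "wf (inv_image {(x, y). x < (y :: 'b)} (inv g))"
      by (rule wf_inv_image)
    moreover have "?r - Id \<subseteq> inv_image {(x, y). x < (y :: 'b)} (inv g)"
      using assms by (auto simp: transported_order_def)
    ultimately show ?thesis
      by (rule wf_subset)
  qed
  ultimately show ?thesis
    by (auto simp: well_order_on_def linear_order_on_def partial_order_on_def preorder_on_def)
qed

lemma transported_order_less:
  fixes g :: "'b::wellorder \<Rightarrow> 'c"
  assumes "inj g" "\<beta> \<in> D" "\<And>x. x < \<beta> \<Longrightarrow> x \<in> D"
  shows "(transported_order g {..<\<beta>}, transported_order g D) \<in> ordLess"
proof -
  let ?r = "transported_order g D"
  have u: "underS ?r (g \<beta>) = g ` {..<\<beta>}"
    using assms by (auto simp: underS_def transported_order_def inj_eq)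
  have "Restr ?r (underS ?r (g \<beta>)) = transported_order g {..<\<beta>}"
    unfolding u using assms by (auto simp: transported_order_def inj_eq)
  moreover have "Restr ?r (underS ?r (g \<beta>)) <o ?r"
    using Well_order_transported_order[OF assms(1)] underS_Restr_ordLess[of ?r] assms(2)
    by (metis Field_transported_order empty_iff image_is_empty)
  ultimately show ?thesis
    by simp
qed

lemma ordIso_refl_transported_order:
  assumes "inj g"
  shows "(transported_order g D, transported_order g D) \<in> ordIso"
  using Well_order_transported_order[OF assms] by (simp add: ordIso_reflexive)

lemma Well_order_rep_ordinal: "Well_order (rep_ordinal \<alpha>)"
  using Quotient_rep_reflp[OF Quotient_ordinal] ordIso_selfD by blast

text \<open>An ordinal below \<alpha> is the type of a proper initial segment of
  \<open>rep_ordinal \<alpha>\<close>, so it is named by the element of the carrier that bounds the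
  segment.\<close>

lemma card_lessThan_ordinal: "|{..<\<alpha> :: 'a ordinal}| \<le>o |UNIV :: (nat + 'a) set|"
proof -
  let ?r = "rep_ordinal \<alpha>"
  have "{..<\<alpha>} \<subseteq> (\<lambda>a. abs_ordinal (Restr ?r (underS ?r a))) ` Field ?r"
  proof
    fix \<beta> assume "\<beta> \<in> {..<\<alpha>}"
    then have "(rep_ordinal \<beta>, ?r) \<in> ordLess"
      by (simp add: less_ordinal.rep_eq)
    then obtain a where a: "a \<in> Field ?r" "rep_ordinal \<beta> =o Restr ?r (underS ?r a)"
      using ordLess_iff_ordIso_Restr Well_order_rep_ordinal by blast
    then have "\<beta> = abs_ordinal (Restr ?r (underS ?r a))"
      using Quotient_rel_abs[OF Quotient_ordinal a(2)] Quotient_abs_rep[OF Quotient_ordinal, of \<beta>]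
      by simp
    with a show "\<beta> \<in> (\<lambda>a. abs_ordinal (Restr ?r (underS ?r a))) ` Field ?r"
      by blast
  qed
  then have "|{..<\<alpha>}| \<le>o |Field ?r|"
    by (rule surj_imp_ordLeq)
  also have "|Field ?r| \<le>o |UNIV :: (nat + 'a) set|"
    by (rule card_of_mono1) simp
  finally show ?thesis .
qed

text \<open>Burali-Forti: otherwise the order type of all ordinals would be an ordinal of the same
  type, and it would exceed the type of its own initial segment.\<close>

lemma card_UNIV_ordinal: "\<not> |UNIV :: 'a ordinal set| \<le>o |UNIV :: (nat + 'a) set|"
proof
  assume "|UNIV :: 'a ordinal set| \<le>o |UNIV :: (nat + 'a) set|"
  then obtain g :: "'a ordinal \<Rightarrow> nat + 'a" where g: "inj g"
    by (auto simp flip: card_of_ordLeq)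
  define seg where "seg D = abs_ordinal (transported_order g D)" for D
  have seg_less: "seg {..<\<beta>} < seg D" if "\<beta> \<in> D" "\<And>x. x < \<beta> \<Longrightarrow> x \<in> D" for \<beta> D
    unfolding seg_def
    by (subst less_ordinal.abs_eq)
      (auto intro: ordIso_refl_transported_order transported_order_less g that)
  have "\<alpha> \<le> seg {..<\<alpha>}" for \<alpha>
  proof (induction \<alpha> rule: less_induct)
    case (less \<alpha>)
    show ?case
    proof (rule ccontr)
      assume "\<not> \<alpha> \<le> seg {..<\<alpha>}"
      then have *: "seg {..<\<alpha>} < \<alpha>"
        by simp
      then have "seg {..<seg {..<\<alpha>}} < seg {..<\<alpha>}"
        by (intro seg_less) auto
      with less[OF *] show False
        by simp
    qed
  qed
  then have "seg UNIV \<le> seg {..<seg UNIV}" .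
  also have "\<dots> < seg UNIV"
    by (rule seg_less) auto
  finally show False
    by simp
qed

text \<open>Regularity: if S were cofinal, every ordinal would lie in S or in one of the initial
  segments given by its elements, and a small union of small sets is small because
  \<open>nat + 'a\<close> is infinite.\<close>

lemma small_set_bounded:
  fixes S :: "'a ordinal set"
  assumes "|S| \<le>o |UNIV :: (nat + 'a) set|"
  shows "\<exists>b. \<forall>x\<in>S. x < b"
proof (rule ccontr)
  assume "\<nexists>b. \<forall>x\<in>S. x < b"
  then have "\<exists>x\<in>S. b \<le> x" for b
    by (meson not_le)
  then have "UNIV \<subseteq> S \<union> (\<Union>x\<in>S. {..<x})"
    by (force simp: le_less)
  moreover have "|\<Union>x\<in>S. {..<x}| \<le>o |UNIV :: (nat + 'a) set|"
    using assms card_lessThan_ordinal by (intro card_of_UNION_ordLeq_infinite) auto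
  then have "|S \<union> (\<Union>x\<in>S. {..<x})| \<le>o |UNIV :: (nat + 'a) set|"
    using assms by (intro card_of_Un_ordLeq_infinite_Field) (auto simp: card_of_card_order_on Field_card_of)
  ultimately show False
    by (metis card_UNIV_ordinal top.extremum_uniqueI)
qed

lemma image_bounded:
  fixes f :: "'a ordinal \<Rightarrow> 'a ordinal"
  shows "\<exists>b. \<forall>x<\<alpha>. f x < b"
proof -
  have "|f ` {..<\<alpha>}| \<le>o |UNIV :: (nat + 'a) set|"
    using card_of_image card_lessThan_ordinal ordLeq_transitive by blast
  from small_set_bounded[OF this] show ?thesis
    by auto
qed

lemma sequence_bounded:
  fixes f :: "nat \<Rightarrow> 'a ordinal"
  shows "\<exists>b. \<forall>n. f n < b"
proof -
  \<comment> \<open>The summand \<open>nat\<close> of the carrier is what makes countable families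
    small.\<close>
  have "range f \<subseteq> (f \<circ> inv Inl) ` (UNIV :: (nat + 'a) set)"
    by (auto simp: image_iff) (metis inj_Inl inv_f_f)
  then have "|range f| \<le>o |UNIV :: (nat + 'a) set|"
    by (rule surj_imp_ordLeq)
  from small_set_bounded[OF this] show ?thesis
    by auto
qed

section \<open>Suprema and ordinal addition\<close>

text \<open>\<open>osup\<close> is a \<open>LEAST\<close> and means something only for bounded sets;
  the equivalences for images and ranges below discharge this condition once and for all.\<close>

lemma osup_upper:
  assumes "\<exists>b. \<forall>x\<in>S. x \<le> b" "x \<in> S"
  shows "x \<le> osup S"
proof -
  obtain b where "\<forall>x\<in>S. x \<le> b"
    using assms by blast
  then have "\<forall>x\<in>S. x \<le> osup S"
    unfolding osup_def by (rule LeastI)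
  with assms show ?thesis
    by blast
qed

lemma osup_least: "(\<And>x. x \<in> S \<Longrightarrow> x \<le> b) \<Longrightarrow> osup S \<le> b"
  unfolding osup_def by (rule Least_le) blast

lemma osup_image_le_iff:
  fixes f :: "'a ordinal \<Rightarrow> 'a ordinal"
  shows "osup (f ` {..<\<alpha>}) \<le> b \<longleftrightarrow> (\<forall>x<\<alpha>. f x \<le> b)"
proof -
  obtain c where c: "\<forall>x<\<alpha>. f x < c"
    using image_bounded by blast
  then have "f x \<le> osup (f ` {..<\<alpha>})" if "x < \<alpha>" for x
    using that by (intro osup_upper exI[of _ c]) auto
  moreover have "osup (f ` {..<\<alpha>}) \<le> b" if "\<forall>x<\<alpha>. f x \<le> b"
    using that by (intro osup_least) auto
  ultimately show ?thesis
    by (meson order_trans)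
qed

lemma osup_insert_image_le_iff:
  fixes f :: "'a ordinal \<Rightarrow> 'a ordinal"
  shows "osup (insert a (f ` {..<\<alpha>})) \<le> b \<longleftrightarrow> a \<le> b \<and> (\<forall>x<\<alpha>. f x \<le> b)"
proof -
  obtain c where "\<forall>x<\<alpha>. f x < c"
    using image_bounded by blast
  then have c: "\<forall>x\<in>insert a (f ` {..<\<alpha>}). x \<le> max a c"
    by (auto simp: le_max_iff_disj)
  then have "f x \<le> osup (insert a (f ` {..<\<alpha>}))" if "x < \<alpha>" for x
    using that by (intro osup_upper exI[of _ "max a c"]) auto
  moreover have "a \<le> osup (insert a (f ` {..<\<alpha>}))"
    using c by (intro osup_upper exI[of _ "max a c"]) auto
  moreover have "osup (insert a (f ` {..<\<alpha>})) \<le> b" if "a \<le> b \<and> (\<forall>x<\<alpha>. f x \<le> b)"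
    using that by (intro osup_least) auto
  ultimately show ?thesis
    by (meson order_trans)
qed

lemma osup_range_le_iff:
  fixes f :: "nat \<Rightarrow> 'a ordinal"
  shows "osup (range f) \<le> b \<longleftrightarrow> (\<forall>n. f n \<le> b)"
proof -
  obtain c where c: "\<forall>n. f n < c"
    using sequence_bounded by blast
  then have "f n \<le> osup (range f)" for n
    by (intro osup_upper exI[of _ c]) (auto simp: less_imp_le)
  then show ?thesis
    using order_trans by (auto intro: osup_least)
qed

lemma less_osup_range_iff:
  fixes f :: "nat \<Rightarrow> 'a ordinal"
  shows "b < osup (range f) \<longleftrightarrow> (\<exists>n. b < f n)"
  using osup_range_le_iff[of f b] by (simp flip: not_le)

lemma ordinal_zero_le [simp]: "0 \<le> (\<alpha> :: 'a ordinal)"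
  unfolding zero_ordinal_def by (rule Least_le) simp

lemma ordinal_le_zero [simp]: "\<alpha> \<le> 0 \<longleftrightarrow> \<alpha> = (0 :: 'a ordinal)"
  by (simp add: eq_iff)

lemma ordinal_not_less_zero [simp]: "\<not> \<alpha> < (0 :: 'a ordinal)"
  by (simp add: not_less)

lemma ordinal_pos_iff: "0 < \<alpha> \<longleftrightarrow> \<alpha> \<noteq> (0 :: 'a ordinal)"
  by (simp add: less_le)

lemma osucc_le_iff: "osucc \<alpha> \<le> \<beta> \<longleftrightarrow> \<alpha> < (\<beta> :: 'a ordinal)"
proof -
  obtain b where "\<alpha> < b"
    using sequence_bounded[of "\<lambda>_. \<alpha>"] by blast
  then have "\<alpha> < osucc \<alpha>"
    unfolding osucc_def by (rule LeastI)
  then show ?thesis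
    unfolding osucc_def by (metis Least_le less_le_trans)
qed

text \<open>The universal property of the recursion. The laws of addition follow from it by
  antisymmetry, without distinguishing successors from limits.\<close>

lemma plus_ordinal_le_iff:
  "\<alpha> + \<beta> \<le> (\<gamma> :: 'a ordinal) \<longleftrightarrow> \<alpha> \<le> \<gamma> \<and> (\<forall>\<eta><\<beta>. \<alpha> + \<eta> < \<gamma>)"
  by (subst plus_ordinal.simps) (simp add: osup_insert_image_le_iff osucc_le_iff)

lemma ordinal_add_zero_right [simp]: "\<alpha> + 0 = (\<alpha> :: 'a ordinal)"
  using plus_ordinal_le_iff[of \<alpha> 0] by (auto intro: antisym)

lemma ordinal_add_mono_right: "\<beta> \<le> \<beta>' \<Longrightarrow> \<alpha> + \<beta> \<le> \<alpha> + (\<beta>' :: 'a ordinal)"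
  by (meson plus_ordinal_le_iff dual_order.refl less_le_trans)

lemma ordinal_add_less_cancel [simp]: "\<alpha> + \<beta> < \<alpha> + \<beta>' \<longleftrightarrow> \<beta> < (\<beta>' :: 'a ordinal)"
  by (meson plus_ordinal_le_iff dual_order.refl ordinal_add_mono_right not_le)

lemma ordinal_add_le_cancel [simp]: "\<alpha> + \<beta> \<le> \<alpha> + \<beta>' \<longleftrightarrow> \<beta> \<le> (\<beta>' :: 'a ordinal)"
  by (meson ordinal_add_less_cancel not_le)

lemma ordinal_add_eq_cancel [simp]: "\<alpha> + \<beta> = \<alpha> + \<beta>' \<longleftrightarrow> \<beta> = (\<beta>' :: 'a ordinal)"
  by (simp add: eq_iff)

lemma osucc_eq: "osucc \<alpha> = (\<alpha> + 1 :: 'a ordinal)"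
proof -
  have *: "\<eta> < 1 \<longleftrightarrow> \<eta> = 0" for \<eta> :: "'a ordinal"
    unfolding one_ordinal_def by (metis osucc_le_iff not_less ordinal_le_zero)
  have "\<alpha> + 1 \<le> \<gamma> \<longleftrightarrow> osucc \<alpha> \<le> \<gamma>" for \<gamma> :: "'a ordinal"
    by (subst plus_ordinal_le_iff) (auto simp: * osucc_le_iff)
  then show ?thesis
    by (metis eq_iff order_refl)
qed

lemma ordinal_succ_le_iff [simp]: "\<alpha> + 1 \<le> \<beta> \<longleftrightarrow> \<alpha> < (\<beta> :: 'a ordinal)"
  by (simp flip: osucc_eq add: osucc_le_iff)

lemma ordinal_less_succ_iff [simp]: "\<alpha> < \<beta> + 1 \<longleftrightarrow> \<alpha> \<le> (\<beta> :: 'a ordinal)"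
  by (meson ordinal_succ_le_iff not_le)

lemma ordinal_add_zero_left [simp]: "0 + \<beta> = (\<beta> :: 'a ordinal)"
proof (induction \<beta> rule: less_induct)
  case (less \<beta>)
  have "0 + \<beta> \<le> \<gamma> \<longleftrightarrow> \<beta> \<le> \<gamma>" for \<gamma>
    by (subst plus_ordinal_le_iff) (auto simp: less, meson not_le order_refl)
  then show ?case
    by (metis eq_iff order_refl)
qed

lemma ordinal_one [simp]: "0 < (1 :: 'a ordinal)" "\<alpha> < (1 :: 'a ordinal) \<longleftrightarrow> \<alpha> = 0"
    "1 \<le> \<alpha> \<longleftrightarrow> 0 < (\<alpha> :: 'a ordinal)"
  using ordinal_less_succ_iff[of \<alpha> 0] ordinal_less_succ_iff[of 0 0] ordinal_succ_le_iff[of 0 \<alpha>]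
  by simp_all

lemma ordinal_le_add_left [simp]: "\<alpha> \<le> \<alpha> + (\<beta> :: 'a ordinal)"
  using ordinal_add_mono_right[of 0 \<beta> \<alpha>] by simp

lemma ordinal_less_add_left [simp]: "\<alpha> < \<alpha> + \<beta> \<longleftrightarrow> 0 < (\<beta> :: 'a ordinal)"
  using ordinal_add_less_cancel[of \<alpha> 0 \<beta>] by simp

lemma ordinal_add_mono_left: "\<alpha> \<le> \<alpha>' \<Longrightarrow> \<alpha> + \<beta> \<le> \<alpha>' + (\<beta> :: 'a ordinal)"
proof (induction \<beta> rule: less_induct)
  case (less \<beta>)
  show ?case
  proof (subst plus_ordinal_le_iff, intro conjI allI impI)
    show "\<alpha> \<le> \<alpha>' + \<beta>"
      using less.prems order_trans ordinal_le_add_left by blast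
    show "\<alpha> + \<eta> < \<alpha>' + \<beta>" if "\<eta> < \<beta>" for \<eta>
      using less.IH[OF that less.prems] that ordinal_add_less_cancel le_less_trans by blast
  qed
qed

lemma ordinal_add_mono: "\<alpha> \<le> \<alpha>' \<Longrightarrow> \<beta> \<le> \<beta>' \<Longrightarrow> \<alpha> + \<beta> \<le> \<alpha>' + (\<beta>' :: 'a ordinal)"
  using ordinal_add_mono_left ordinal_add_mono_right order_trans by blast

lemma ordinal_le_add_right [simp]: "\<beta> \<le> \<alpha> + (\<beta> :: 'a ordinal)"
  using ordinal_add_mono_left[of 0 \<alpha> \<beta>] by simp

lemma ordinal_add_eq_zero [simp]: "\<alpha> + \<beta> = 0 \<longleftrightarrow> \<alpha> = 0 \<and> \<beta> = (0 :: 'a ordinal)"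
  by (metis ordinal_add_zero_left ordinal_le_add_left ordinal_le_zero)

lemma ordinal_le_obtain_add:
  fixes \<alpha> \<beta> :: "'a ordinal"
  assumes "\<alpha> \<le> \<beta>"
  obtains \<rho> where "\<beta> = \<alpha> + \<rho>"
proof -
  \<comment> \<open>Minimality puts \<alpha> + \<eta> below \<beta> for every \<eta> < \<rho>, which
    yields the inequality from above.\<close>
  define \<rho> where "\<rho> = (LEAST \<rho>. \<beta> \<le> \<alpha> + \<rho>)"
  have "\<beta> \<le> \<alpha> + \<beta>"
    by simp
  then have "\<beta> \<le> \<alpha> + \<rho>"
    unfolding \<rho>_def by (rule LeastI)
  moreover have "\<alpha> + \<rho> \<le> \<beta>"
    by (subst plus_ordinal_le_iff) (use assms not_less_Least in \<open>fastforce simp: \<rho>_def\<close>)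
  ultimately show thesis
    using that by force
qed

lemma ordinal_add_assoc: "(\<alpha> + \<beta>) + \<gamma> = \<alpha> + (\<beta> + (\<gamma> :: 'a ordinal))"
proof (induction \<gamma> rule: less_induct)
  case (less \<gamma>)
  have "\<alpha> + \<beta> + \<gamma> \<le> \<alpha> + (\<beta> + \<gamma>)"
    by (subst plus_ordinal_le_iff) (auto simp: less)
  moreover have "\<alpha> + (\<beta> + \<gamma>) \<le> \<alpha> + \<beta> + \<gamma>"
  proof (subst plus_ordinal_le_iff, intro conjI allI impI)
    show "\<alpha> \<le> \<alpha> + \<beta> + \<gamma>"
      using order_trans ordinal_le_add_left by blast
    fix \<eta> assume "\<eta> < \<beta> + \<gamma>"
    show "\<alpha> + \<eta> < \<alpha> + \<beta> + \<gamma>"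
    proof (cases "\<eta> < \<beta>")
      case True
      then have "\<alpha> + \<eta> < \<alpha> + \<beta>"
        by simp
      then show ?thesis
        using less_le_trans ordinal_le_add_left by blast
    next
      case False
      then obtain \<rho> where "\<eta> = \<beta> + \<rho>"
        by (meson not_le ordinal_le_obtain_add)
      with less \<open>\<eta> < \<beta> + \<gamma>\<close> show ?thesis
        by (metis ordinal_add_less_cancel)
    qed
  qed
  ultimately show ?case
    by simp
qed

section \<open>Multiplication, powers of omega and normal functions\<close>

lemma times_ordinal_le_iff: "\<alpha> * \<beta> \<le> (\<gamma> :: 'a ordinal) \<longleftrightarrow> (\<forall>\<eta><\<beta>. \<alpha> * \<eta> + \<alpha> \<le> \<gamma>)"
  by (subst times_ordinal.simps) (simp add: osup_image_le_iff)

lemma ordinal_mult_zero_right [simp]: "\<alpha> * 0 = (0 :: 'a ordinal)"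
  using times_ordinal_le_iff[of \<alpha> 0 0] by simp

lemma ordinal_mult_mono_right: "\<beta> \<le> \<beta>' \<Longrightarrow> \<alpha> * \<beta> \<le> \<alpha> * (\<beta>' :: 'a ordinal)"
  by (meson times_ordinal_le_iff order_refl less_le_trans)

lemma ordinal_mult_succ: "\<alpha> * (\<beta> + 1) = \<alpha> * \<beta> + (\<alpha> :: 'a ordinal)"
proof (rule antisym)
  show "\<alpha> * (\<beta> + 1) \<le> \<alpha> * \<beta> + \<alpha>"
    by (subst times_ordinal_le_iff) (simp add: ordinal_add_mono_left ordinal_mult_mono_right)
  show "\<alpha> * \<beta> + \<alpha> \<le> \<alpha> * (\<beta> + 1)"
    using times_ordinal_le_iff[of \<alpha> "\<beta> + 1" "\<alpha> * (\<beta> + 1)"] by simp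
qed

lemma ordinal_mult_one_right [simp]: "\<alpha> * 1 = (\<alpha> :: 'a ordinal)"
  using ordinal_mult_succ[of \<alpha> 0] by simp

lemma ordinal_mult_mono_left: "\<alpha> \<le> \<alpha>' \<Longrightarrow> \<alpha> * \<beta> \<le> \<alpha>' * (\<beta> :: 'a ordinal)"
proof (induction \<beta> rule: less_induct)
  case (less \<beta>)
  show ?case
  proof (subst times_ordinal_le_iff, intro allI impI)
    fix \<eta> assume "\<eta> < \<beta>"
    then have "\<alpha> * \<eta> + \<alpha> \<le> \<alpha>' * \<eta> + \<alpha>'"
      using less by (simp add: ordinal_add_mono)
    also have "\<dots> \<le> \<alpha>' * \<beta>"
      using \<open>\<eta> < \<beta>\<close> times_ordinal_le_iff by blast
    finally show "\<alpha> * \<eta> + \<alpha> \<le> \<alpha>' * \<beta>" .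
  qed
qed

lemma less_omega_iff: "\<alpha> < omega \<longleftrightarrow> (\<exists>n. \<alpha> < ord_of_nat n)"
  unfolding omega_def by (rule less_osup_range_iff)

lemma mono_ord_of_nat: "m \<le> n \<Longrightarrow> ord_of_nat m \<le> (ord_of_nat n :: 'a ordinal)"
  by (induction rule: dec_induct) (auto intro: order_trans)

lemma ord_of_nat_le_omega: "ord_of_nat n \<le> (omega :: 'a ordinal)"
  unfolding omega_def by (meson osup_range_le_iff order_refl)

lemma ordinal_mult_omega_le_iff: "\<alpha> * omega \<le> \<gamma> \<longleftrightarrow> (\<forall>n. \<alpha> * ord_of_nat n \<le> (\<gamma> :: 'a ordinal))"
proof safe
  fix n assume "\<alpha> * omega \<le> \<gamma>"
  then show "\<alpha> * ord_of_nat n \<le> \<gamma>"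
    by (meson ord_of_nat_le_omega ordinal_mult_mono_right order_trans)
next
  assume *: "\<forall>n. \<alpha> * ord_of_nat n \<le> \<gamma>"
  show "\<alpha> * omega \<le> \<gamma>"
  proof (subst times_ordinal_le_iff, intro allI impI)
    fix \<eta> :: "'a ordinal" assume "\<eta> < omega"
    then obtain n where "\<eta> + 1 \<le> ord_of_nat n"
      by (auto simp: less_omega_iff)
    then have "\<alpha> * (\<eta> + 1) \<le> \<gamma>"
      using * ordinal_mult_mono_right order_trans by blast
    then show "\<alpha> * \<eta> + \<alpha> \<le> \<gamma>"
      by (simp add: ordinal_mult_succ)
  qed
qed

lemma less_ordinal_mult_omega_iff:
  "\<gamma> < \<alpha> * omega \<longleftrightarrow> (\<exists>n. \<gamma> < \<alpha> * (ord_of_nat n :: 'a ordinal))"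
  by (meson ordinal_mult_omega_le_iff not_le)

lemma ordinal_mult_ord_of_nat_add:
  "\<alpha> * ord_of_nat (m + n) = \<alpha> * ord_of_nat m + \<alpha> * (ord_of_nat n :: 'a ordinal)"
  by (induction n) (simp_all add: ordinal_mult_succ ordinal_add_assoc)

lemma ordinal_mult_ord_of_nat_mono:
  "\<alpha> \<le> \<alpha>' \<Longrightarrow> m \<le> n \<Longrightarrow> \<alpha> * ord_of_nat m \<le> \<alpha>' * (ord_of_nat n :: 'a ordinal)"
  by (meson mono_ord_of_nat ordinal_mult_mono_left ordinal_mult_mono_right order_trans)

lemma ordinal_le_mult_ord_of_nat: "0 < n \<Longrightarrow> \<alpha> \<le> \<alpha> * (ord_of_nat n :: 'a ordinal)"
  using ordinal_mult_ord_of_nat_mono[of \<alpha> \<alpha> "Suc 0" n] by simp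

lemma omega_pow_le_iff:
  "omega_pow \<beta> \<le> (\<gamma> :: 'a ordinal) \<longleftrightarrow> 0 < \<gamma> \<and> (\<forall>\<eta><\<beta>. omega_pow \<eta> * omega \<le> \<gamma>)"
  by (subst omega_pow.simps) (simp add: osup_insert_image_le_iff)

lemma omega_pow_pos [simp]: "0 < omega_pow (\<beta> :: 'a ordinal)" "omega_pow \<beta> \<noteq> (0 :: 'a ordinal)"
proof -
  show "0 < omega_pow \<beta>"
    using omega_pow_le_iff[of \<beta> "omega_pow \<beta>"] by simp
  then show "omega_pow \<beta> \<noteq> 0"
    by auto
qed

lemma omega_pow_zero [simp]: "omega_pow 0 = (1 :: 'a ordinal)"
  by (rule antisym) (simp_all add: omega_pow_le_iff)

lemma omega_pow_mult_ord_of_nat_less: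
  "\<alpha> < \<beta> \<Longrightarrow> omega_pow \<alpha> * ord_of_nat n < (omega_pow \<beta> :: 'a ordinal)"
proof -
  assume "\<alpha> < \<beta>"
  have "omega_pow \<alpha> * ord_of_nat n < omega_pow \<alpha> * ord_of_nat (Suc n)"
    by (simp add: ordinal_mult_succ)
  also have "\<dots> \<le> omega_pow \<beta>"
    using \<open>\<alpha> < \<beta>\<close> omega_pow_le_iff[of \<beta> "omega_pow \<beta>"] ordinal_mult_omega_le_iff by blast
  finally show ?thesis .
qed

lemma omega_pow_less: "\<alpha> < \<beta> \<Longrightarrow> omega_pow \<alpha> < (omega_pow \<beta> :: 'a ordinal)"
  using omega_pow_mult_ord_of_nat_less[of \<alpha> \<beta> 1] by simp

lemma strict_mono_omega_pow: "strict_mono (omega_pow :: 'a ordinal \<Rightarrow> 'a ordinal)"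
  by (rule strict_monoI) (rule omega_pow_less)

lemmas omega_pow_less_iff [simp] = strict_mono_less[OF strict_mono_omega_pow]
  and omega_pow_mono_iff [simp] = strict_mono_less_eq[OF strict_mono_omega_pow]
  and omega_pow_eq_iff [simp] = strict_mono_eq[OF strict_mono_omega_pow]

lemma less_omega_powE:
  fixes \<gamma> :: "'a ordinal"
  assumes "\<gamma> < omega_pow \<beta>" "0 < \<beta>"
  obtains \<eta> n where "\<eta> < \<beta>" "\<gamma> < omega_pow \<eta> * ord_of_nat n"
proof (cases "\<gamma> = 0")
  case True
  show thesis
    by (rule that[OF assms(2), of 1]) (simp add: True)
next
  case False
  with assms(1) omega_pow_le_iff[of \<beta> \<gamma>] obtain \<eta> where "\<eta> < \<beta>" "\<gamma> < omega_pow \<eta> * omega"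
    by (auto simp: not_le ordinal_pos_iff simp flip: not_less)
  with that show thesis
    by (auto simp: less_ordinal_mult_omega_iff)
qed

text \<open>Additive indecomposability: both summands lie below finite multiples of a common smaller
  power, and the sum of these is again a finite multiple of it.\<close>

lemma add_less_omega_pow:
  fixes x y :: "'a ordinal"
  assumes "x < omega_pow \<beta>" "y < omega_pow \<beta>"
  shows "x + y < omega_pow \<beta>"
proof (cases "\<beta> = 0")
  case True
  with assms show ?thesis
    by simp
next
  case False
  then have "0 < \<beta>"
    by (simp add: ordinal_pos_iff)
  obtain \<eta> m where x: "\<eta> < \<beta>" "x < omega_pow \<eta> * ord_of_nat m"
    using less_omega_powE[OF assms(1) \<open>0 < \<beta>\<close>] .
  obtain \<theta> n where y: "\<theta> < \<beta>" "y < omega_pow \<theta> * ord_of_nat n"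
    using less_omega_powE[OF assms(2) \<open>0 < \<beta>\<close>] .
  let ?k = "max \<eta> \<theta>"
  have "x + y \<le> omega_pow ?k * ord_of_nat m + omega_pow ?k * ord_of_nat n"
    using x y
    by (intro ordinal_add_mono)
      (meson less_imp_le max.cobounded1 max.cobounded2 omega_pow_mono_iff order_trans ordinal_mult_mono_left)+
  also have "\<dots> = omega_pow ?k * ord_of_nat (m + n)"
    by (rule ordinal_mult_ord_of_nat_add[symmetric])
  also have "\<dots> < omega_pow \<beta>"
    using x y by (intro omega_pow_mult_ord_of_nat_less) simp
  finally show ?thesis .
qed

text \<open>Values of Veblen functions are powers of \<omega>, so successors above 1 are never fixed
  points; iterations started at such a successor therefore move.\<close>

lemma omega_pow_ne_succ:
  assumes "0 < \<alpha>"
  shows "omega_pow \<beta> \<noteq> \<alpha> + (1 :: 'a ordinal)"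
proof
  assume *: "omega_pow \<beta> = \<alpha> + 1"
  then have "\<alpha> + 1 < omega_pow \<beta>"
    using assms by (intro add_less_omega_pow) simp_all
  with * show False
    by simp
qed

lemma add_omega_pow_absorb: "x < omega_pow \<beta> \<Longrightarrow> x + omega_pow \<beta> = (omega_pow \<beta> :: 'a ordinal)"
  by (rule antisym) (auto simp: plus_ordinal_le_iff add_less_omega_pow)

definition limit_ordinal :: "'a ordinal \<Rightarrow> bool" where
  "limit_ordinal \<alpha> \<longleftrightarrow> 0 < \<alpha> \<and> (\<forall>\<eta><\<alpha>. \<eta> + 1 < \<alpha>)"

text \<open>Continuity at limits is phrased by upper bounds \<open>y\<close> rather than by
  \<open>osup\<close>, which keeps boundedness conditions out of the later arguments.\<close>

definition normal_fun :: "('a ordinal \<Rightarrow> 'a ordinal) \<Rightarrow> bool" where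
  "normal_fun f \<longleftrightarrow>
    strict_mono f \<and> (\<forall>\<alpha> y. limit_ordinal \<alpha> \<longrightarrow> (\<forall>\<eta><\<alpha>. f \<eta> \<le> y) \<longrightarrow> f \<alpha> \<le> y)"

lemma normal_fun_strict_mono: "normal_fun f \<Longrightarrow> strict_mono f"
  by (simp add: normal_fun_def)

lemma normal_fun_limit_le:
  "normal_fun f \<Longrightarrow> limit_ordinal \<alpha> \<Longrightarrow> (\<And>\<eta>. \<eta> < \<alpha> \<Longrightarrow> f \<eta> \<le> y) \<Longrightarrow> f \<alpha> \<le> y"
  by (simp add: normal_fun_def)

lemma strict_mono_ordinal_le:
  fixes f :: "'b::wellorder \<Rightarrow> 'b"
  assumes "strict_mono f"
  shows "x \<le> f x"
proof (induction x rule: less_induct)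
  case (less x)
  show ?case
    by (meson assms less not_le strict_monoD)
qed

lemma normal_fun_fixed_limit:
  assumes "normal_fun f" "limit_ordinal \<alpha>" "\<And>\<eta>. \<eta> < \<alpha> \<Longrightarrow> f \<eta> \<le> \<alpha>"
  shows "f \<alpha> = \<alpha>"
  using assms normal_fun_limit_le strict_mono_ordinal_le normal_fun_strict_mono
  by (metis antisym)

lemma limit_ordinal_osup:
  fixes s :: "nat \<Rightarrow> 'a ordinal"
  assumes "\<And>n. s n < s (Suc n)"
  shows "limit_ordinal (osup (range s))"
proof -
  have "0 < osup (range s)"
    using assms[of 0] by (auto simp: less_osup_range_iff intro: le_less_trans[OF ordinal_zero_le])
  moreover have "\<eta> + 1 < osup (range s)" if "\<eta> < osup (range s)" for \<eta>
    using that assms by (auto simp: less_osup_range_iff) (metis ordinal_succ_le_iff le_less_trans)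
  ultimately show ?thesis
    by (simp add: limit_ordinal_def)
qed

lemma normal_fun_omega_pow: "normal_fun (omega_pow :: 'a ordinal \<Rightarrow> 'a ordinal)"
  unfolding normal_fun_def
proof (intro conjI strict_mono_omega_pow allI impI)
  fix \<alpha> y :: "'a ordinal"
  assume "limit_ordinal \<alpha>" and le: "\<forall>\<eta><\<alpha>. omega_pow \<eta> \<le> y"
  then have lim: "0 < \<alpha>" "\<eta> < \<alpha> \<Longrightarrow> \<eta> + 1 < \<alpha>" for \<eta>
    by (auto simp: limit_ordinal_def)
  show "omega_pow \<alpha> \<le> y"
  proof (subst omega_pow_le_iff, intro conjI allI impI)
    show "0 < y"
      using le lim(1) omega_pow_pos less_le_trans by blast
    fix \<eta> assume "\<eta> < \<alpha>"
    then have "omega_pow (\<eta> + 1) \<le> y"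
      using lim le by blast
    then show "omega_pow \<eta> * omega \<le> y"
      by (subst (asm) omega_pow_le_iff) simp
  qed
qed

lemma enum_properties:
  fixes S :: "'a ordinal set"
  assumes "\<And>x. \<exists>y\<in>S. x < y"
  shows enum_in: "enum S \<xi> \<in> S"
    and strict_mono_enum: "strict_mono (enum S)"
    and enum_le: "\<alpha> \<in> S \<Longrightarrow> (\<And>\<eta>. \<eta> < \<xi> \<Longrightarrow> enum S \<eta> < \<alpha>) \<Longrightarrow> enum S \<xi> \<le> \<alpha>"
    and range_enum: "range (enum S) = S"
proof -
  have *: "enum S \<xi> \<in> S \<and> (\<forall>\<eta>\<in>{..<\<xi>}. enum S \<eta> < enum S \<xi>)" for \<xi>
  proof -
    obtain b where b: "\<forall>x<\<xi>. enum S x < b"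
      using image_bounded by blast
    obtain y where "y \<in> S" "b < y"
      using assms by blast
    with b have "y \<in> S \<and> (\<forall>\<eta>\<in>{..<\<xi>}. enum S \<eta> < y)"
      by auto
    then show ?thesis
      by (subst (1 3) enum.simps) (rule LeastI)
  qed
  show "enum S \<xi> \<in> S"
    using * by blast
  show mono: "strict_mono (enum S)"
    using * by (intro strict_monoI) auto
  have least: "enum S \<xi> \<le> \<alpha>" if "\<alpha> \<in> S" "\<And>\<eta>. \<eta> < \<xi> \<Longrightarrow> enum S \<eta> < \<alpha>" for \<xi> \<alpha>
    using that by (subst enum.simps) (intro Least_le, auto)
  then show "\<alpha> \<in> S \<Longrightarrow> (\<And>\<eta>. \<eta> < \<xi> \<Longrightarrow> enum S \<eta> < \<alpha>) \<Longrightarrow> enum S \<xi> \<le> \<alpha>"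
    by blast
  have "\<alpha> \<in> range (enum S)" if "\<alpha> \<in> S" for \<alpha>
  proof -
    \<comment> \<open>The only candidate for the index of \<alpha>: all earlier values are below
      \<alpha>, so \<open>least\<close> bounds this value by \<alpha>.\<close>
    define \<xi> where "\<xi> = (LEAST \<xi>. \<alpha> \<le> enum S \<xi>)"
    have "\<alpha> \<le> enum S \<alpha>"
      using mono by (rule strict_mono_ordinal_le)
    then have "\<alpha> \<le> enum S \<xi>"
      unfolding \<xi>_def by (rule LeastI)
    moreover have "enum S \<xi> \<le> \<alpha>"
      using that not_less_Least by (intro least) (force simp: \<xi>_def)+
    ultimately show ?thesis
      by (metis antisym rangeI)
  qed
  with * show "range (enum S) = S"
    by auto
qed

text \<open>Since the index set is small, a single function \<open>G\<close> dominates all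
  \<open>F i\<close> at once. The supremum of its iterates from x + 1 is closed under each
  \<open>F i\<close>, and a normal function fixes a limit that it does not leave.\<close>

lemma common_fixed_points_unbounded:
  fixes F :: "'a ordinal \<Rightarrow> 'a ordinal \<Rightarrow> 'a ordinal"
  assumes F: "\<And>i. i < \<delta> \<Longrightarrow> normal_fun (F i)"
  shows "\<exists>y\<in>{y. \<forall>i<\<delta>. F i y = y}. x < y"
proof -
  have "\<exists>b. z < b \<and> (\<forall>i<\<delta>. F i z \<le> b)" for z
  proof -
    obtain c where "\<forall>i<\<delta>. F i z < c"
      using image_bounded[of \<delta> "\<lambda>i. F i z"] by blast
    then show ?thesis
      by (intro exI[of _ "max c (z + 1)"]) (auto simp: less_max_iff_disj le_max_iff_disj)
  qed
  then obtain G where G: "\<And>z. z < G z" "\<And>z i. i < \<delta> \<Longrightarrow> F i z \<le> G z"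
    by metis
  define s where "s n = (G ^^ n) (x + 1)" for n
  have s: "s n < s (Suc n)" "i < \<delta> \<Longrightarrow> F i (s n) \<le> s (Suc n)" for n i
    using G by (simp_all add: s_def)
  let ?y = "osup (range s)"
  have "F i ?y = ?y" if "i < \<delta>" for i
  proof (rule normal_fun_fixed_limit[OF F[OF that]])
    show "limit_ordinal ?y"
      by (rule limit_ordinal_osup) (rule s)
    fix \<eta> assume "\<eta> < ?y"
    then obtain n where "\<eta> < s n"
      by (auto simp: less_osup_range_iff)
    then have "F i \<eta> < F i (s n)"
      using F[OF that] by (simp add: normal_fun_strict_mono strict_monoD)
    also have "\<dots> \<le> s (Suc n)"
      using s that by blast
    finally show "F i \<eta> \<le> ?y"
      by (meson less_osup_range_iff less_imp_le)
  qed
  moreover have "x < ?y"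
    by (subst less_osup_range_iff, rule exI[of _ 0]) (simp add: s_def)
  ultimately show ?thesis
    by blast
qed

text \<open>Continuity holds because the supremum of the earlier values at a limit is itself a
  common fixed point, so the enumeration cannot pass over it.\<close>

lemma normal_fun_enum_common_fixed_points:
  fixes F :: "'a ordinal \<Rightarrow> 'a ordinal \<Rightarrow> 'a ordinal"
  assumes F: "\<And>i. i < \<delta> \<Longrightarrow> normal_fun (F i)"
  shows "normal_fun (enum {y. \<forall>i<\<delta>. F i y = y})"
    and "range (enum {y. \<forall>i<\<delta>. F i y = y}) = {y. \<forall>i<\<delta>. F i y = y}"
proof -
  let ?S = "{y. \<forall>i<\<delta>. F i y = y}"
  let ?e = "enum ?S"
  note unb = common_fixed_points_unbounded[of \<delta> F, OF F]
  show "range ?e = ?S"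
    by (rule range_enum[OF unb])
  show "normal_fun ?e"
    unfolding normal_fun_def
  proof (intro conjI allI impI)
    show "strict_mono ?e"
      by (rule strict_mono_enum[OF unb])
    fix \<alpha> y assume lim: "limit_ordinal \<alpha>" and le: "\<forall>\<eta><\<alpha>. ?e \<eta> \<le> y"
    define s where "s = osup (?e ` {..<\<alpha>})"
    have less_s: "b < s \<longleftrightarrow> (\<exists>\<eta><\<alpha>. b < ?e \<eta>)" for b
      unfolding s_def using osup_image_le_iff[of ?e \<alpha> b] by (auto simp flip: not_le)
    have e_less: "?e \<eta> < s" if "\<eta> < \<alpha>" for \<eta>
      using lim that strict_monoD[OF strict_mono_enum[OF unb], of \<eta> "\<eta> + 1"]
      by (auto simp: less_s limit_ordinal_def)
    have lim_s: "limit_ordinal s"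
      unfolding limit_ordinal_def
    proof (intro conjI allI impI)
      show "0 < s"
        using e_less[of 0] lim by (auto simp: limit_ordinal_def intro: le_less_trans[OF ordinal_zero_le])
      fix \<eta> assume "\<eta> < s"
      then obtain \<theta> where "\<theta> < \<alpha>" "\<eta> + 1 \<le> ?e \<theta>"
        by (auto simp: less_s)
      then show "\<eta> + 1 < s"
        using e_less le_less_trans by blast
    qed
    have "F i s = s" if "i < \<delta>" for i
    proof (rule normal_fun_fixed_limit[OF F[OF that] lim_s])
      fix z assume "z < s"
      then obtain \<eta> where "\<eta> < \<alpha>" "z < ?e \<eta>"
        using less_s by blast
      then have "F i z < F i (?e \<eta>)"
        using F[OF that] by (simp add: normal_fun_strict_mono strict_monoD)
      also have "\<dots> = ?e \<eta>"
        using enum_in[OF unb, of \<eta>] that by auto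
      finally show "F i z \<le> s"
        using e_less[OF \<open>\<eta> < \<alpha>\<close>] by simp
    qed
    then have "?e \<alpha> \<le> s"
      using e_less by (intro enum_le[OF unb]) auto
    also have "s \<le> y"
      using le by (simp add: s_def osup_image_le_iff)
    finally show "?e \<alpha> \<le> y" .
  qed
qed

section \<open>Cantor normal forms\<close>

text \<open>For \<open>\<alpha> > 0\<close> this says that the last exponent in the Cantor normal form of \<open>\<alpha>\<close> is at
  least \<open>e\<close>; it holds vacuously for \<open>\<alpha> = 0\<close>.\<close>

definition exponents_ge :: "'a ordinal \<Rightarrow> 'a ordinal \<Rightarrow> bool" where
  "exponents_ge e \<alpha> \<longleftrightarrow> (\<forall>x<\<alpha>. x + omega_pow e \<le> \<alpha>)"

lemma exponents_ge_zero [simp]: "exponents_ge e 0"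
  by (simp add: exponents_ge_def)

lemma exponents_geD: "exponents_ge e \<alpha> \<Longrightarrow> x < \<alpha> \<Longrightarrow> x + omega_pow e \<le> \<alpha>"
  by (simp add: exponents_ge_def)

lemma exponents_ge_omega_pow_le: "exponents_ge e \<alpha> \<Longrightarrow> 0 < \<alpha> \<Longrightarrow> omega_pow e \<le> \<alpha>"
  using exponents_geD[of e \<alpha> 0] by simp

lemma exponents_ge_omega_pow: "e \<le> e' \<Longrightarrow> exponents_ge e (omega_pow e')"
  unfolding exponents_ge_def
  by (metis add_less_omega_pow add_omega_pow_absorb le_less omega_pow_less)

lemma exponents_ge_add:
  assumes "exponents_ge e' \<tau>" "e \<le> e'" "exponents_ge e \<sigma>"
  shows "exponents_ge e (\<tau> + \<sigma>)"
  unfolding exponents_ge_def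
proof (intro allI impI)
  fix x assume x: "x < \<tau> + \<sigma>"
  show "x + omega_pow e \<le> \<tau> + \<sigma>"
  proof (cases "x < \<tau>")
    case True
    have "x + omega_pow e \<le> x + omega_pow e'"
      using assms(2) by simp
    also have "\<dots> \<le> \<tau>"
      using assms(1) True by (rule exponents_geD)
    also have "\<dots> \<le> \<tau> + \<sigma>"
      by simp
    finally show ?thesis .
  next
    case False
    then obtain y where y: "x = \<tau> + y"
      by (meson not_le ordinal_le_obtain_add)
    with x assms(3) show ?thesis
      by (simp add: exponents_geD ordinal_add_assoc)
  qed
qed

text \<open>If a < b, a head longer by \<rho> would give \<rho> + \<open>omega_pow a\<close> =
  \<open>omega_pow b\<close> with both summands below \<open>omega_pow b\<close>. If the exponents
  agree, the shorter head plus the last term does not exceed the longer head.\<close>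

lemma decomposition_unique:
  assumes "exponents_ge a \<sigma>" "exponents_ge b \<tau>" "\<sigma> + omega_pow a = \<tau> + omega_pow b"
  shows "\<sigma> = \<tau> \<and> a = b"
proof -
  have not_less: "\<not> a < b"
    if "exponents_ge a \<sigma>" "exponents_ge b \<tau>" "\<sigma> + omega_pow a = \<tau> + omega_pow b" for a b \<sigma> \<tau> :: "'a ordinal"
  proof
    assume ab: "a < b"
    show False
    proof (cases "\<sigma> \<le> \<tau>")
      case True
      then have "\<sigma> + omega_pow a < \<tau> + omega_pow b"
        using ab by (meson le_less_trans omega_pow_less ordinal_add_less_cancel ordinal_add_mono_left)
      with that show False
        by simp
    next
      case False
      then obtain \<rho> where \<rho>: "\<sigma> = \<tau> + \<rho>"
        by (meson nle_le ordinal_le_obtain_add)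
      have "\<sigma> < \<tau> + omega_pow b"
        using that(3) by (metis omega_pow_pos(1) ordinal_less_add_left)
      then have "\<rho> + omega_pow a < omega_pow b"
        using ab by (intro add_less_omega_pow) (simp_all add: \<rho>)
      with that(3) show False
        by (simp add: \<rho> ordinal_add_assoc)
    qed
  qed
  have "a = b"
    using not_less[OF assms] not_less[OF assms(2,1) assms(3)[symmetric]] by simp
  moreover have "\<not> \<sigma> < \<tau>"
    using exponents_geD[OF assms(2), of \<sigma>] assms(3) \<open>a = b\<close>
    by (metis omega_pow_pos(1) not_le ordinal_less_add_left)
  moreover have "\<not> \<tau> < \<sigma>"
    using exponents_geD[OF assms(1), of \<tau>] assms(3) \<open>a = b\<close>
    by (metis omega_pow_pos(1) not_le ordinal_less_add_left)
  ultimately show ?thesis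
    by simp
qed

text \<open>A finite multiple of a power of \<omega> cannot end strictly inside the last term of a
  Cantor normal form. This handles a sum \<gamma> above a member
  \<open>omega_pow e * ord_of_nat n\<close>: the head of \<gamma>, which \<gamma>[n] keeps, is
  already large enough.\<close>

lemma omega_pow_mult_le_head:
  assumes "exponents_ge a \<tau>" "0 < \<tau>" "omega_pow e * ord_of_nat n < \<tau> + omega_pow a"
  shows "omega_pow e * ord_of_nat n \<le> \<tau>"
  using assms(3)
proof (induction n)
  case (Suc n)
  let ?w = "omega_pow e * ord_of_nat n"
  have "?w < \<tau> + omega_pow a"
    using Suc.prems by (simp add: ordinal_mult_succ) (meson le_less_trans ordinal_le_add_left)
  with Suc.IH obtain \<rho> where \<rho>: "\<tau> = ?w + \<rho>"
    using ordinal_le_obtain_add by blast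
  have less: "omega_pow e < \<rho> + omega_pow a"
    using Suc.prems by (simp add: \<rho> ordinal_mult_succ ordinal_add_assoc)
  have "omega_pow e \<le> \<rho>"
  proof (rule ccontr)
    assume "\<not> ?thesis"
    then have "\<rho> < omega_pow e"
      by simp
    \<comment> \<open>Otherwise \<rho> and \<open>omega_pow a\<close> would both be below
      \<open>omega_pow e\<close>, and so would their sum.\<close>
    with less have "e \<le> a"
      using add_less_omega_pow omega_pow_less not_le less_asym by metis
    show False
    proof (cases "\<rho> = 0")
      case True
      with less have "?w < omega_pow a"
        by (intro omega_pow_mult_ord_of_nat_less) simp
      with True \<rho> exponents_ge_omega_pow_le[OF assms(1,2)] show False
        by simp
    next
      case False
      then have "?w + omega_pow a \<le> \<tau>"
        by (intro exponents_geD[OF assms(1)]) (simp add: \<rho> ordinal_pos_iff)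
      then show False
        using \<open>\<rho> < omega_pow e\<close> \<open>e \<le> a\<close> \<rho> by (meson leD le_less_trans less_le_trans omega_pow_mono_iff ordinal_add_le_cancel order_trans)
    qed
  qed
  then show ?case
    by (simp add: \<rho> ordinal_mult_succ)
qed simp

lemma cantor_normal_form_Cons:
  "cantor_normal_form (e # es) \<alpha> \<longleftrightarrow>
    (\<forall>x\<in>set es. x \<le> e) \<and> (\<exists>\<sigma>. cantor_normal_form es \<sigma> \<and> \<alpha> = omega_pow e + \<sigma>)"
  by (auto simp: cantor_normal_form_def)

lemma cantor_normal_form_Nil [simp]: "cantor_normal_form [] \<alpha> \<longleftrightarrow> \<alpha> = 0"
  by (simp add: cantor_normal_form_def)

text \<open>The leading exponent \<open>e\<close> is an exponent below the first power
  \<open>omega_pow b\<close> exceeding \<alpha> for which some finite multiple of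
  \<open>omega_pow e\<close> exceeds \<alpha>; the remainder is treated by induction.\<close>

lemma cantor_normal_form_exists: "\<exists>es. cantor_normal_form es (\<alpha> :: 'a ordinal)"
proof (induction \<alpha> rule: less_induct)
  case (less \<alpha>)
  show ?case
  proof (cases "\<alpha> = 0")
    case True
    then show ?thesis
      by (intro exI[of _ "[]"]) simp
  next
    case False
    define b where "b = (LEAST b. \<alpha> < omega_pow b)"
    have "\<alpha> < omega_pow (\<alpha> + 1)"
      using strict_mono_ordinal_le[OF strict_mono_omega_pow, of "\<alpha> + 1"] by simp
    then have b: "\<alpha> < omega_pow b"
      unfolding b_def by (rule LeastI)
    have b_le: "omega_pow e \<le> \<alpha>" if "e < b" for e
      using that not_less_Least not_le unfolding b_def by blast
    have "0 < b"
      using b False by (auto simp: ordinal_pos_iff)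
    from less_omega_powE[OF b this] obtain e n where e: "e < b" "\<alpha> < omega_pow e * ord_of_nat n" .
    obtain \<sigma> where \<sigma>: "\<alpha> = omega_pow e + \<sigma>"
      using b_le[OF e(1)] ordinal_le_obtain_add by blast
    \<comment> \<open>The remainder must be smaller for the induction. If \<alpha> absorbed
      \<open>omega_pow e\<close> from the left, it would absorb every finite multiple, although one
      of them exceeds \<alpha>.\<close>
    have "\<sigma> \<noteq> \<alpha>"
    proof
      assume "\<sigma> = \<alpha>"
      with \<sigma> have absorb: "omega_pow e + \<alpha> = \<alpha>"
        by simp
      have "omega_pow e * ord_of_nat n + \<alpha> = \<alpha>"
        by (induction n) (simp_all add: ordinal_mult_succ ordinal_add_assoc absorb)
      then show False
        using e(2) by (metis leD ordinal_le_add_left)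
    qed
    moreover have "\<sigma> \<le> \<alpha>"
      by (simp add: \<sigma>)
    ultimately have "\<sigma> < \<alpha>"
      by simp
    from less[OF this] obtain es where es: "cantor_normal_form es \<sigma>" ..
    have "\<forall>x\<in>set es. x \<le> e"
    proof (cases es)
      case (Cons y ys)
      with es have "omega_pow y \<le> \<sigma>" "\<forall>x\<in>set ys. x \<le> y"
        by (auto simp: cantor_normal_form_Cons)
      then have "\<not> b \<le> y"
        using b \<open>\<sigma> \<le> \<alpha>\<close> by (meson leD le_less_trans less_le_trans omega_pow_mono_iff order_trans)
      have "\<not> e < y"
      proof
        assume "e < y"
        then have "omega_pow e * ord_of_nat n < omega_pow y"
          by (rule omega_pow_mult_ord_of_nat_less)
        with e(2) \<open>omega_pow y \<le> \<sigma>\<close> \<open>\<sigma> \<le> \<alpha>\<close> show False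
          by simp
      qed
      with \<open>\<forall>x\<in>set ys. x \<le> y\<close> Cons show ?thesis
        by auto
    qed simp
    with es \<sigma> show ?thesis
      by (metis cantor_normal_form_Cons)
  qed
qed

lemma cantor_normal_form_exponents_ge:
  "cantor_normal_form es \<alpha> \<Longrightarrow> (\<And>x. x \<in> set es \<Longrightarrow> e \<le> x) \<Longrightarrow> exponents_ge e \<alpha>"
proof (induction es arbitrary: \<alpha>)
  case (Cons x es)
  then show ?case
    by (auto simp: cantor_normal_form_Cons intro!: exponents_ge_add[OF exponents_ge_omega_pow])
qed simp

lemma cantor_normal_form_last_le: "cantor_normal_form es \<alpha> \<Longrightarrow> x \<in> set es \<Longrightarrow> last es \<le> x"
proof (induction es arbitrary: \<alpha>)
  case (Cons y es)
  then have "x = y \<or> last es \<le> x" if "es \<noteq> []"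
    unfolding cantor_normal_form_Cons by auto
  moreover have "last es \<le> y" if "es \<noteq> []"
    using Cons.prems(1) that by (simp add: cantor_normal_form_Cons)
  ultimately show ?case
    using Cons.prems(2) by auto
qed simp

lemma cantor_normal_form_last:
  "cantor_normal_form es \<alpha> \<Longrightarrow> es \<noteq> [] \<Longrightarrow>
    \<exists>\<tau>. exponents_ge (last es) \<tau> \<and> \<alpha> = \<tau> + omega_pow (last es)"
proof (induction es arbitrary: \<alpha>)
  case (Cons y es)
  show ?case
  proof (cases "es = []")
    case True
    with Cons.prems show ?thesis
      by (intro exI[of _ 0]) (auto simp: cantor_normal_form_Cons)
  next
    case False
    from Cons.prems obtain \<sigma> where \<sigma>: "cantor_normal_form es \<sigma>" "\<alpha> = omega_pow y + \<sigma>"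
      and le: "\<forall>x\<in>set es. x \<le> y"
      by (auto simp: cantor_normal_form_Cons)
    from Cons.IH[OF \<sigma>(1) False] obtain \<tau> where \<tau>: "exponents_ge (last es) \<tau>" "\<sigma> = \<tau> + omega_pow (last es)"
      by blast
    with le False \<sigma> show ?thesis
      by (intro exI[of _ "omega_pow y + \<tau>"]) (auto simp: ordinal_add_assoc intro!: exponents_ge_add[OF exponents_ge_omega_pow])
  qed
qed simp

text \<open>Translates the side condition of the rule \<open>sum\<close> into an order condition, so
  that lists of exponents can be forgotten afterwards.\<close>

lemma cantor_normal_form_iff_exponents_ge:
  assumes "0 < \<alpha>"
  shows "(\<exists>es. cantor_normal_form es \<alpha> \<and> e \<le> last es) \<longleftrightarrow> exponents_ge e \<alpha>"
proof
  assume "\<exists>es. cantor_normal_form es \<alpha> \<and> e \<le> last es"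
  then show "exponents_ge e \<alpha>"
    by (meson cantor_normal_form_exponents_ge cantor_normal_form_last_le order_trans)
next
  assume e: "exponents_ge e \<alpha>"
  obtain es where es: "cantor_normal_form es \<alpha>"
    using cantor_normal_form_exists by blast
  with assms have "es \<noteq> []"
    by auto
  from cantor_normal_form_last[OF es this] obtain \<tau> where \<tau>: "\<alpha> = \<tau> + omega_pow (last es)"
    by blast
  then have "\<tau> + omega_pow e \<le> \<alpha>"
    by (intro exponents_geD[OF e]) simp
  with \<tau> es show "\<exists>es. cantor_normal_form es \<alpha> \<and> e \<le> last es"
    by auto
qed

lemma ordinal_decomposition:
  fixes \<alpha> :: "'a ordinal"
  assumes "0 < \<alpha>"
  obtains \<tau> a where "exponents_ge a \<tau>" "\<alpha> = \<tau> + omega_pow a"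
proof -
  obtain es where es: "cantor_normal_form es \<alpha>"
    using cantor_normal_form_exists by blast
  with assms have "es \<noteq> []"
    by auto
  from cantor_normal_form_last[OF es this] that show thesis
    by blast
qed

section \<open>The Veblen hierarchy and the shapes of ordinals\<close>

lemma veblen_zero_left: "veblen 0 = omega_pow"
  by (subst veblen.simps) simp

lemma veblen_eq_enum: "0 < \<delta> \<Longrightarrow> veblen \<delta> = enum {y. \<forall>i<\<delta>. veblen i y = y}"
  by (subst veblen.simps) (simp add: Ball_def ordinal_pos_iff)

lemma normal_fun_veblen: "normal_fun (veblen (\<delta> :: 'a ordinal))"
proof (induction \<delta> rule: less_induct)
  case (less \<delta>)
  show ?case
  proof (cases "\<delta> = 0")
    case True
    then show ?thesis
      by (simp add: veblen_zero_left normal_fun_omega_pow)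
  next
    case False
    then show ?thesis
      using normal_fun_enum_common_fixed_points(1)[of \<delta> veblen] less
      by (simp add: veblen_eq_enum ordinal_pos_iff)
  qed
qed

lemmas strict_mono_veblen = normal_fun_strict_mono[OF normal_fun_veblen]

lemmas veblen_less_iff [simp] = strict_mono_less[OF strict_mono_veblen]
  and veblen_le_iff [simp] = strict_mono_less_eq[OF strict_mono_veblen]
  and veblen_eq_iff [simp] = strict_mono_eq[OF strict_mono_veblen]
  and le_veblen [simp] = strict_mono_ordinal_le[OF strict_mono_veblen]

lemma range_veblen: "0 < \<delta> \<Longrightarrow> range (veblen \<delta>) = {y. \<forall>i<\<delta>. veblen i y = (y :: 'a ordinal)}"
  using normal_fun_enum_common_fixed_points(2)[of \<delta> veblen, OF normal_fun_veblen]
  by (simp add: veblen_eq_enum)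

lemma veblen_veblen: "i < \<delta> \<Longrightarrow> veblen i (veblen \<delta> x) = (veblen \<delta> x :: 'a ordinal)"
  using range_veblen[of \<delta>] le_less_trans[OF ordinal_zero_le] by blast

lemma veblen_mono_left: "i \<le> \<delta> \<Longrightarrow> veblen i x \<le> (veblen \<delta> x :: 'a ordinal)"
  by (metis le_less le_veblen veblen_le_iff veblen_veblen)

lemma veblen_mono: "i \<le> \<delta> \<Longrightarrow> x \<le> y \<Longrightarrow> veblen i x \<le> (veblen \<delta> y :: 'a ordinal)"
  by (meson order_trans veblen_le_iff veblen_mono_left)

lemma veblen_fixed_antimono: "veblen \<delta> x = x \<Longrightarrow> i \<le> \<delta> \<Longrightarrow> veblen i x = (x :: 'a ordinal)"
  by (metis antisym le_veblen veblen_mono_left)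

lemma less_veblen_iff: "x < veblen \<delta> x \<longleftrightarrow> veblen \<delta> x \<noteq> (x :: 'a ordinal)"
  by (metis le_less le_veblen less_irrefl)

lemma veblen_eq_omega_pow: "\<exists>e. veblen \<delta> x = (omega_pow e :: 'a ordinal)"
  by (metis ordinal_pos_iff veblen_veblen veblen_zero_left)

lemma veblen_pos [simp]: "0 < (veblen \<delta> x :: 'a ordinal)"
  by (metis veblen_eq_omega_pow omega_pow_pos(1))

lemma veblen_fixed_pos: "veblen \<delta> x = x \<Longrightarrow> 0 < (x :: 'a ordinal)"
  by (metis veblen_pos)

lemma veblen_fixed_omega_pow: "veblen \<delta> x = x \<Longrightarrow> omega_pow x = (x :: 'a ordinal)"
  by (metis ordinal_zero_le veblen_fixed_antimono veblen_zero_left)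

lemma omega_pow_veblen: "0 < \<delta> \<Longrightarrow> omega_pow (veblen \<delta> x) = (veblen \<delta> x :: 'a ordinal)"
  by (metis veblen_veblen veblen_zero_left)

lemma less_veblen_succ: "0 < x \<Longrightarrow> x + 1 < veblen \<delta> (x + 1 :: 'a ordinal)"
  by (metis less_veblen_iff omega_pow_ne_succ veblen_fixed_omega_pow)

lemma less_veblen_zero: "0 < veblen \<delta> (0 :: 'a ordinal)"
  by simp

lemma strict_mono_veblen_zero: "strict_mono (\<lambda>\<delta>. veblen \<delta> (0 :: 'a ordinal))"
proof (rule strict_monoI)
  fix \<delta> \<delta>' :: "'a ordinal" assume "\<delta> < \<delta>'"
  have "veblen \<delta> 0 < veblen \<delta> (veblen \<delta>' 0)"
    by simp
  then show "veblen \<delta> 0 < veblen \<delta>' 0"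
    by (simp add: veblen_veblen \<open>\<delta> < \<delta>'\<close>)
qed

lemmas veblen_zero_less_iff [simp] = strict_mono_less[OF strict_mono_veblen_zero]
  and veblen_zero_le_iff [simp] = strict_mono_less_eq[OF strict_mono_veblen_zero]
  and le_veblen_zero [simp] = strict_mono_ordinal_le[OF strict_mono_veblen_zero]

lemma left_le_veblen [simp]: "\<delta> \<le> (veblen \<delta> x :: 'a ordinal)"
  by (meson le_veblen_zero order_trans ordinal_zero_le veblen_le_iff)

lemma left_less_veblen: "0 < x \<Longrightarrow> \<delta> < (veblen \<delta> x :: 'a ordinal)"
  by (meson le_less_trans le_veblen_zero veblen_less_iff)

text \<open>At a limit \<alpha>, the supremum of the earlier values is fixed by
  \<open>veblen i\<close> for all i < \<alpha>, hence is a value of \<open>veblen \<alpha>\<close>,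
  and \<open>veblen \<alpha> 0\<close> is the least of these.\<close>

lemma normal_fun_veblen_zero: "normal_fun (\<lambda>\<delta>. veblen \<delta> (0 :: 'a ordinal))"
  unfolding normal_fun_def
proof (intro conjI strict_mono_veblen_zero allI impI)
  fix \<alpha> y :: "'a ordinal"
  assume lim: "limit_ordinal \<alpha>" and le: "\<forall>\<eta><\<alpha>. veblen \<eta> 0 \<le> y"
  define s where "s = osup ((\<lambda>\<eta>. veblen \<eta> 0) ` {..<\<alpha>})"
  have less_s: "b < s \<longleftrightarrow> (\<exists>\<eta><\<alpha>. b < veblen \<eta> 0)" for b
    unfolding s_def using osup_image_le_iff[of "\<lambda>\<eta>. veblen \<eta> 0" \<alpha> b] by (auto simp flip: not_le)
  have less_s': "veblen \<eta> 0 < s" if "\<eta> < \<alpha>" for \<eta>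
    using lim that unfolding less_s limit_ordinal_def
    by (intro exI[of _ "\<eta> + 1"]) simp
  have lim_s: "limit_ordinal s"
    unfolding limit_ordinal_def
  proof (intro conjI allI impI)
    show "0 < s"
      using less_s'[of 0] lim by (auto simp: limit_ordinal_def intro: le_less_trans[OF ordinal_zero_le])
    fix \<eta> assume "\<eta> < s"
    then obtain \<theta> where "\<theta> < \<alpha>" "\<eta> + 1 \<le> veblen \<theta> 0"
      by (auto simp: less_s)
    then show "\<eta> + 1 < s"
      using less_s' le_less_trans by blast
  qed
  have "veblen i s = s" if "i < \<alpha>" for i
  proof (rule normal_fun_fixed_limit[OF normal_fun_veblen lim_s])
    fix z assume "z < s"
    then obtain \<eta> where \<eta>: "\<eta> < \<alpha>" "z < veblen \<eta> 0"
      by (auto simp: less_s)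
    \<comment> \<open>The index must be at least \<eta> to pass z, and greater than i so that its
      value is fixed by \<open>veblen i\<close>.\<close>
    let ?m = "max \<eta> (i + 1)"
    have "z < veblen ?m 0"
      using \<eta>(2) by (meson less_le_trans max.cobounded1 veblen_zero_le_iff)
    then have "veblen i z < veblen i (veblen ?m 0)"
      by simp
    also have "\<dots> = veblen ?m 0"
      by (rule veblen_veblen) (simp add: less_max_iff_disj)
    also have "\<dots> < s"
      using lim \<open>i < \<alpha>\<close> \<eta>(1) by (intro less_s') (simp add: limit_ordinal_def)
    finally show "veblen i z \<le> s"
      by simp
  qed
  moreover have "0 < \<alpha>"
    using lim by (simp add: limit_ordinal_def)
  ultimately have "s \<in> range (veblen \<alpha>)"
    by (simp add: range_veblen)
  then have "veblen \<alpha> 0 \<le> s"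
    by auto
  also have "s \<le> y"
    using le by (simp add: s_def osup_image_le_iff)
  finally show "veblen \<alpha> 0 \<le> y" .
qed

text \<open>The fixed points of a single normal function are the common fixed points of a family
  indexed by the ordinals below 1.\<close>

lemma normal_fun_Gamma: "normal_fun (Gamma :: 'a ordinal \<Rightarrow> 'a ordinal)"
  and range_Gamma: "range Gamma = {\<alpha>. veblen \<alpha> 0 = (\<alpha> :: 'a ordinal)}"
  using normal_fun_enum_common_fixed_points[of 1 "\<lambda>_ \<delta>. veblen \<delta> (0 :: 'a ordinal)",
      OF normal_fun_veblen_zero]
  by (simp_all add: Gamma_def)

lemmas strict_mono_Gamma = normal_fun_strict_mono[OF normal_fun_Gamma]

lemmas Gamma_less_iff [simp] = strict_mono_less[OF strict_mono_Gamma]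
  and Gamma_le_iff [simp] = strict_mono_less_eq[OF strict_mono_Gamma]
  and Gamma_eq_iff [simp] = strict_mono_eq[OF strict_mono_Gamma]

lemma veblen_Gamma_zero [simp]: "veblen (Gamma \<xi>) 0 = (Gamma \<xi> :: 'a ordinal)"
  using range_Gamma by blast

lemma Gamma_pos [simp]: "0 < (Gamma \<xi> :: 'a ordinal)"
  by (metis veblen_Gamma_zero veblen_pos)

lemma veblen_Gamma: "\<delta> < Gamma \<xi> \<Longrightarrow> veblen \<delta> (Gamma \<xi>) = (Gamma \<xi> :: 'a ordinal)"
  by (metis veblen_Gamma_zero veblen_veblen)

lemma less_veblen_zero_iff: "\<delta> < veblen \<delta> 0 \<longleftrightarrow> (\<nexists>\<xi>. \<delta> = (Gamma \<xi> :: 'a ordinal))"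
proof -
  have "\<delta> \<in> range Gamma \<longleftrightarrow> veblen \<delta> 0 = \<delta>"
    by (simp add: range_Gamma)
  then show ?thesis
    using le_veblen_zero[of \<delta>] by (auto simp: le_less image_iff)
qed

section \<open>Veblen normal forms and the distinction of shapes\<close>

text \<open>For \<gamma> < \<delta> the common value would be fixed by
  \<open>veblen \<gamma>\<close>, and injectivity would make \<alpha> equal to
  \<open>veblen \<gamma> \<alpha>\<close>.\<close>

lemma veblen_normal_form_unique:
  fixes \<alpha> \<beta> :: "'a ordinal"
  assumes "veblen \<gamma> \<alpha> = veblen \<delta> \<beta>" "\<alpha> < veblen \<gamma> \<alpha>" "\<beta> < veblen \<delta> \<beta>"
  shows "\<gamma> = \<delta> \<and> \<alpha> = \<beta>"
proof -
  have False if "\<gamma> < \<delta>" "veblen \<gamma> \<alpha> = veblen \<delta> \<beta>" "\<alpha> < veblen \<gamma> \<alpha>" for \<gamma> \<delta> \<alpha> \<beta> :: "'a ordinal"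
    using that by (metis less_irrefl veblen_eq_iff veblen_veblen)
  from this[of \<gamma> \<delta> \<alpha> \<beta>] this[of \<delta> \<gamma> \<beta> \<alpha>] assms have "\<gamma> = \<delta>"
    by (metis linorder_neqE)
  with assms show ?thesis
    by simp
qed

lemma Gamma_ne_veblen: "\<delta> < Gamma \<xi> \<Longrightarrow> \<alpha> < Gamma \<xi> \<Longrightarrow> Gamma \<xi> \<noteq> (veblen \<delta> \<alpha> :: 'a ordinal)"
  by (metis Gamma_pos less_irrefl veblen_Gamma_zero veblen_normal_form_unique)

text \<open>Take the first index \<delta> that moves \<alpha>. All smaller ones fix \<alpha>, so
  \<alpha> is a value of \<open>veblen \<delta>\<close>; if \<delta> is \<alpha> itself, the
  argument must be 0 and \<alpha> is some \<open>Gamma \<xi>\<close>.\<close>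

lemma omega_pow_fixed_cases:
  fixes \<alpha> :: "'a ordinal"
  assumes "omega_pow \<alpha> = \<alpha>"
  obtains \<delta> \<beta> where "0 < \<delta>" "\<delta> < \<alpha>" "\<beta> < \<alpha>" "\<alpha> = veblen \<delta> \<beta>"
  | \<xi> where "\<alpha> = Gamma \<xi>"
proof -
  have "0 < \<alpha>"
    using assms by (metis omega_pow_pos(1))
  define \<delta> where "\<delta> = (LEAST \<delta>. \<alpha> < veblen \<delta> \<alpha>)"
  have "\<alpha> < veblen \<alpha> \<alpha>"
    using \<open>0 < \<alpha>\<close> by (rule left_less_veblen)
  then have less: "\<alpha> < veblen \<delta> \<alpha>" and "\<delta> \<le> \<alpha>"
    unfolding \<delta>_def by (rule LeastI, rule Least_le)
  have fixed: "veblen i \<alpha> = \<alpha>" if "i < \<delta>" for i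
    using that not_less_Least less_veblen_iff unfolding \<delta>_def by blast
  have "0 < \<delta>"
    using less assms by (auto simp: ordinal_pos_iff veblen_zero_left)
  with fixed range_veblen[of \<delta>] obtain \<beta> where \<beta>: "\<alpha> = veblen \<delta> \<beta>"
    by blast
  have "\<beta> < \<alpha>"
    using less \<beta> veblen_less_iff by metis
  show thesis
  proof (cases "\<delta> = \<alpha>")
    case True
    then have "\<beta> = 0"
      using \<beta> left_less_veblen[of \<beta> \<delta>] by (auto simp: ordinal_pos_iff)
    with True \<beta> show thesis
      using that(2) less_veblen_zero_iff by (metis less_irrefl)
  next
    case False
    with \<open>\<delta> \<le> \<alpha>\<close> \<open>0 < \<delta>\<close> \<open>\<beta> < \<alpha>\<close> \<beta> show thesis
      by (intro that(1)) (auto simp: less_le)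
  qed
qed

text \<open>The cases follow the rules, except that \<open>veblen\<close> also covers argument 0 and
  \<open>Gamma\<close> also covers index 0. The condition \<delta> <
  \<open>veblen \<delta> \<beta>\<close> keeps the last two cases apart.\<close>

lemma ordinal_shape_cases [consumes 1, case_names sum one omega_pow veblen Gamma]:
  fixes \<alpha> :: "'a ordinal"
  assumes "0 < \<alpha>"
  obtains \<tau> a where "0 < \<tau>" "exponents_ge a \<tau>" "\<alpha> = \<tau> + omega_pow a"
  | "\<alpha> = 1"
  | a where "0 < a" "a < omega_pow a" "\<alpha> = omega_pow a"
  | \<delta> \<beta> where "0 < \<delta>" "\<delta> < veblen \<delta> \<beta>" "\<beta> < veblen \<delta> \<beta>" "\<alpha> = veblen \<delta> \<beta>"
  | \<xi> where "\<alpha> = Gamma \<xi>"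
proof -
  obtain \<tau> a where \<tau>: "exponents_ge a \<tau>" "\<alpha> = \<tau> + omega_pow a"
    using ordinal_decomposition[OF assms] .
  show thesis
  proof (cases "\<tau> = 0")
    case False
    then show thesis
      using that(1) \<tau> by (simp add: ordinal_pos_iff)
  next
    case True
    with \<tau> have eq: "\<alpha> = omega_pow a"
      by simp
    show thesis
    proof (cases "omega_pow a = a")
      case True
      then show thesis
        using that(4,5) eq by (metis omega_pow_fixed_cases)
    next
      case False
      then have "a < omega_pow a"
        using strict_mono_ordinal_le[OF strict_mono_omega_pow, of a] by simp
      then show thesis
        using that(2,3) eq by (cases "a = 0") (auto simp: ordinal_pos_iff)
    qed
  qed
qed

lemma sum_ne_omega_pow:
  "0 < \<tau> \<Longrightarrow> exponents_ge a \<tau> \<Longrightarrow> \<tau> + omega_pow a \<noteq> (omega_pow e :: 'a ordinal)"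
  using decomposition_unique[of a \<tau> e 0] by auto

lemma Gamma_eq_omega_pow: "omega_pow (Gamma \<xi>) = (Gamma \<xi> :: 'a ordinal)"
  by (metis Gamma_pos veblen_Gamma veblen_zero_left)

text \<open>An index of the shapes of ordinals that the rules distinguish, used to see that at most one
  rule applies to an ordinal.\<close>

definition shape :: "'a ordinal \<Rightarrow> nat" where
  "shape x =
    (if x = 0 then 0 else if x \<notin> range omega_pow then 1 else if x = 1 then 2
     else if omega_pow x \<noteq> x then 3 else if x \<notin> range Gamma then 4 else 5)"

lemma shape_zero: "shape 0 = 0"
  by (simp add: shape_def)

lemma shape_sum: "0 < \<tau> \<Longrightarrow> exponents_ge a \<tau> \<Longrightarrow> shape (\<tau> + omega_pow a) = 1"
  using sum_ne_omega_pow[of \<tau> a] by (simp add: shape_def image_iff ordinal_pos_iff)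

lemma one_eq_omega_pow_iff: "1 = omega_pow a \<longleftrightarrow> a = (0 :: 'a ordinal)"
  by (metis omega_pow_zero omega_pow_eq_iff)

lemma shape_one: "shape (1 :: 'a ordinal) = 2"
  using one_eq_omega_pow_iff[where 'a='a] by (auto simp: shape_def)

lemma shape_omega_pow: "0 < a \<Longrightarrow> a < omega_pow a \<Longrightarrow> shape (omega_pow a) = 3"
  using one_eq_omega_pow_iff[of a] by (auto simp: shape_def)

lemma omega_pow_one_ne: "omega_pow 1 \<noteq> (1 :: 'a ordinal)"
  by (metis one_eq_omega_pow_iff ordinal_one(1) less_irrefl)

lemma shape_veblen:
  assumes "0 < \<delta>" "\<delta> < veblen \<delta> \<alpha>" "\<alpha> < veblen \<delta> \<alpha>"
  shows "shape (veblen \<delta> \<alpha>) = 4"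
proof -
  have "veblen \<delta> \<alpha> \<in> range omega_pow"
    using veblen_eq_omega_pow by blast
  moreover have "veblen \<delta> \<alpha> \<noteq> 1"
    using omega_pow_veblen[OF assms(1)] omega_pow_one_ne by metis
  moreover have "veblen \<delta> \<alpha> \<notin> range Gamma"
    using assms Gamma_ne_veblen by (metis imageE)
  moreover have "veblen \<delta> \<alpha> \<noteq> 0"
    using veblen_pos[of \<delta> \<alpha>] by (simp add: ordinal_pos_iff)
  ultimately show ?thesis
    using omega_pow_veblen[OF assms(1)] by (simp add: shape_def)
qed

lemma shape_Gamma: "shape (Gamma \<xi>) = 5"
proof -
  have "Gamma \<xi> \<in> range omega_pow"
    using Gamma_eq_omega_pow by (metis rangeI)
  moreover have "Gamma \<xi> \<noteq> 1"
    using Gamma_eq_omega_pow omega_pow_one_ne by metis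
  moreover have "Gamma \<xi> \<noteq> 0"
    using Gamma_pos[of \<xi>] by (simp add: ordinal_pos_iff)
  ultimately show ?thesis
    by (simp add: shape_def Gamma_eq_omega_pow)
qed

section \<open>The rules determine exactly one value\<close>

text \<open>The numbers from \<open>shape\<close> keep the disjuncts apart: once the shape of x is
  known, simplification leaves one of them. Both Veblen rules share a disjunct, with
  \<open>b\<close> for the start of the iteration.\<close>

lemma gamma_val_inversion:
  assumes "gamma_val \<zeta> X x n v"
  shows "shape x = 0 \<and> v = 0
    \<or> shape x = 1 \<and> (\<exists>\<tau> a w. 0 < \<tau> \<and> exponents_ge a \<tau> \<and> x = \<tau> + omega_pow a \<and>
        gamma_val \<zeta> X (omega_pow a) n w \<and> v = \<tau> + w)
    \<or> shape x = 2 \<and> v = 0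
    \<or> shape x = 3 \<and> (\<exists>a w. x = omega_pow a \<and> gamma_val \<zeta> X a n w \<and> v = omega_pow w * ord_of_nat n)
    \<or> shape x = 4 \<and> (\<exists>\<delta> \<alpha> \<eta> b. \<alpha> < veblen \<delta> \<alpha> \<and> x = veblen \<delta> \<alpha> \<and> gamma_val \<zeta> X \<delta> n \<eta> \<and>
        (\<alpha> = 0 \<and> b = 0 \<or> 0 < \<alpha> \<and> (\<exists>\<beta>. gamma_val \<zeta> X \<alpha> n \<beta> \<and> b = veblen \<delta> \<beta> + 1)) \<and>
        v = (veblen \<eta> ^^ (n + 1)) b)
    \<or> shape x = 5 \<and> (\<exists>\<xi>. x = Gamma \<xi> \<and>
        v = ((\<lambda>x. veblen x 0) ^^ (n + 1)) (if \<xi> = 0 then 0 else Gamma (X \<xi> n) + 1))"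
  using assms
proof cases
  case (sum \<tau> es a w)
  then have "exponents_ge a \<tau>"
    using cantor_normal_form_iff_exponents_ge by blast
  with sum show ?thesis
    using shape_sum by metis
next
  case (veblen_zero \<delta> \<eta>)
  then have "shape x = 4"
    by (simp add: shape_veblen)
  with veblen_zero show ?thesis
    using less_veblen_zero[of \<delta>] by blast
next
  case (veblen \<alpha> \<delta> \<eta> \<beta>)
  then have "shape x = 4"
    by (simp add: shape_veblen left_less_veblen)
  with veblen show ?thesis
    by blast
next
  case Gamma_zero
  then show ?thesis
    using shape_Gamma by auto
next
  case (Gamma \<xi>)
  then show ?thesis
    using shape_Gamma by auto
next
  case (omega_pow a w)
  then have "shape x = 3"
    by (simp add: shape_omega_pow)
  with omega_pow show ?thesis
    by blast
qed (simp_all add: shape_zero shape_one)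

lemma gamma_val_unique: "gamma_val \<zeta> X x n v \<Longrightarrow> gamma_val \<zeta> X x n v' \<Longrightarrow> v' = v"
proof (induction arbitrary: v' rule: gamma_val.induct)
  case (sum \<tau> es a n w)
  then have ex: "exponents_ge a \<tau>"
    using cantor_normal_form_iff_exponents_ge by blast
  then obtain \<sigma> b u where *: "exponents_ge b \<sigma>" "\<tau> + omega_pow a = \<sigma> + omega_pow b"
      "gamma_val \<zeta> X (omega_pow b) n u" "v' = \<sigma> + u"
    using gamma_val_inversion[OF sum.prems] shape_sum[OF sum.hyps(1) ex] by auto
  from decomposition_unique[OF ex *(1,2)] * sum.IH show ?case
    by simp
next
  case (zero n)
  then show ?case
    using gamma_val_inversion[OF zero.prems] by (simp add: shape_zero)
next
  case (one n)
  then show ?case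
    using gamma_val_inversion[OF one.prems] by (simp add: shape_one)
next
  case (omega_pow a n w)
  have "\<exists>w. gamma_val \<zeta> X a n w \<and> v' = omega_pow w * ord_of_nat n"
    using gamma_val_inversion[OF omega_pow.prems]
    by (simp add: shape_omega_pow omega_pow.hyps(1,2))
  with omega_pow.IH show ?case
    by blast
next
  case (veblen_zero \<delta> n \<eta>)
  then obtain \<delta>' \<alpha> \<eta>' b where *: "\<alpha> < veblen \<delta>' \<alpha>" "veblen \<delta> 0 = veblen \<delta>' \<alpha>" "gamma_val \<zeta> X \<delta>' n \<eta>'"
      "\<alpha> = 0 \<and> b = 0 \<or> 0 < \<alpha>" "v' = (veblen \<eta>' ^^ (n + 1)) b"
    using gamma_val_inversion[OF veblen_zero.prems] shape_veblen[of \<delta> 0] by auto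
  from veblen_normal_form_unique[OF *(2) _ *(1)] * veblen_zero.IH show ?case
    by auto
next
  case (veblen \<alpha>' \<delta> n \<eta> \<beta>)
  have "shape (veblen \<delta> \<alpha>') = 4"
    using veblen.hyps by (simp add: shape_veblen left_less_veblen)
  with gamma_val_inversion[OF veblen.prems]
  obtain \<delta>' \<alpha> \<eta>' b where *: "\<alpha> < veblen \<delta>' \<alpha>" "veblen \<delta> \<alpha>' = veblen \<delta>' \<alpha>" "gamma_val \<zeta> X \<delta>' n \<eta>'"
      "\<alpha> = 0 \<or> (\<exists>\<beta>. gamma_val \<zeta> X \<alpha> n \<beta> \<and> b = veblen \<delta>' \<beta> + 1)" "v' = (veblen \<eta>' ^^ (n + 1)) b"
    by (simp del: funpow.simps add_Suc_right One_nat_def) blast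
  from veblen_normal_form_unique[OF *(2) veblen.hyps(2) *(1)] have eq: "\<delta>' = \<delta>" "\<alpha> = \<alpha>'"
    by auto
  then have "\<eta>' = \<eta>"
    using *(3) veblen.IH(1) by simp
  moreover have "b = veblen \<delta> \<beta> + 1"
    using *(4) eq veblen.IH(2) veblen.hyps(1) by auto
  ultimately show ?case
    using *(5) by simp
next
  case (Gamma_zero n)
  then show ?case
    using gamma_val_inversion[OF Gamma_zero.prems] by (simp add: shape_Gamma)
next
  case (Gamma \<xi> n)
  then show ?case
    using gamma_val_inversion[OF Gamma.prems] by (simp add: shape_Gamma ordinal_pos_iff)
qed

lemma gamma_val_exists: "x \<le> Gamma \<zeta> \<Longrightarrow> \<exists>v. gamma_val \<zeta> X x n v"
proof (induction x rule: less_induct)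
  case (less x)
  show ?case
  proof (cases "x = 0")
    case True
    then show ?thesis
      using gamma_val.zero by blast
  next
    case False
    then have "0 < x"
      by (simp add: ordinal_pos_iff)
    then show ?thesis
    proof (cases rule: ordinal_shape_cases)
      case (sum \<tau> a)
      \<comment> \<open>The last term is smaller than x because the head is at least as large, so
        the induction hypothesis reaches it.\<close>
      have "omega_pow a \<le> \<tau>"
        using sum by (simp add: exponents_ge_omega_pow_le)
      also have "\<tau> < x"
        by (simp add: sum)
      finally obtain v where "gamma_val \<zeta> X (omega_pow a) n v"
        using less by (meson less_imp_le order_trans)
      moreover obtain es where "cantor_normal_form es \<tau>" "a \<le> last es"
        using sum cantor_normal_form_iff_exponents_ge by blast
      ultimately show ?thesis
        using sum gamma_val.sum by blast
    next
      case one
      then show ?thesis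
        using gamma_val.one by blast
    next
      case (omega_pow a)
      then show ?thesis
        using less gamma_val.omega_pow by (meson less_imp_le order_trans)
    next
      case (veblen \<delta> \<beta>)
      then obtain v where v: "gamma_val \<zeta> X \<delta> n v"
        using less by (meson less_imp_le order_trans)
      show ?thesis
      proof (cases "\<beta> = 0")
        case True
        with v veblen show ?thesis
          using gamma_val.veblen_zero by blast
      next
        case False
        obtain w where "gamma_val \<zeta> X \<beta> n w"
          using veblen less by (meson less_imp_le order_trans)
        with v veblen False show ?thesis
          using gamma_val.veblen ordinal_pos_iff by blast
      qed
    next
      case (Gamma \<xi>)
      with less.prems have "\<xi> \<le> \<zeta>"
        by simp
      then show ?thesis
        using Gamma gamma_val.Gamma_zero gamma_val.Gamma ordinal_pos_iff by metis
    qed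
  qed
qed

lemma gamma_system_eqI: "gamma_val \<zeta> X x n v \<Longrightarrow> gamma_system \<zeta> X x n = v"
  unfolding gamma_system_def using gamma_val_unique by blast

lemma gamma_val_gamma_system:
  "x \<le> Gamma \<zeta> \<Longrightarrow> gamma_val \<zeta> X x n (gamma_system \<zeta> X x n)"
  using gamma_val_exists gamma_system_eqI by metis

lemma gamma_system_zero [simp]: "gamma_system \<zeta> X 0 n = 0"
  by (rule gamma_system_eqI) (rule gamma_val.zero)

lemma gamma_system_one [simp]: "gamma_system \<zeta> X 1 n = 0"
  by (rule gamma_system_eqI) (rule gamma_val.one)

lemma gamma_system_sum:
  assumes "0 < \<tau>" "exponents_ge a \<tau>" "\<tau> + omega_pow a \<le> Gamma \<zeta>"
  shows "gamma_system \<zeta> X (\<tau> + omega_pow a) n = \<tau> + gamma_system \<zeta> X (omega_pow a) n"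
proof -
  obtain es where "cantor_normal_form es \<tau>" "a \<le> last es"
    using assms cantor_normal_form_iff_exponents_ge by blast
  moreover have "omega_pow a \<le> Gamma \<zeta>"
    using assms(3) ordinal_le_add_right order_trans by blast
  ultimately show ?thesis
    using assms by (intro gamma_system_eqI gamma_val.sum gamma_val_gamma_system) auto
qed

lemma gamma_system_omega_pow:
  assumes "0 < a" "a < omega_pow a" "omega_pow a \<le> Gamma \<zeta>"
  shows "gamma_system \<zeta> X (omega_pow a) n = omega_pow (gamma_system \<zeta> X a n) * ord_of_nat n"
  using assms by (intro gamma_system_eqI gamma_val.omega_pow gamma_val_gamma_system) auto

lemma gamma_system_veblen_zero:
  assumes "0 < \<delta>" "\<delta> < veblen \<delta> 0" "veblen \<delta> 0 \<le> Gamma \<zeta>"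
  shows "gamma_system \<zeta> X (veblen \<delta> 0) n = (veblen (gamma_system \<zeta> X \<delta> n) ^^ (n + 1)) 0"
  using assms by (intro gamma_system_eqI gamma_val.veblen_zero gamma_val_gamma_system) auto

lemma gamma_system_veblen:
  assumes "0 < \<alpha>" "\<alpha> < veblen \<delta> \<alpha>" "0 < \<delta>" "veblen \<delta> \<alpha> \<le> Gamma \<zeta>"
  shows "gamma_system \<zeta> X (veblen \<delta> \<alpha>) n =
    (veblen (gamma_system \<zeta> X \<delta> n) ^^ (n + 1)) (veblen \<delta> (gamma_system \<zeta> X \<alpha> n) + 1)"
proof -
  have "\<delta> \<le> Gamma \<zeta>"
    using assms(4) left_le_veblen order_trans by blast
  with assms show ?thesis
    by (intro gamma_system_eqI gamma_val.veblen gamma_val_gamma_system) auto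
qed

lemma gamma_system_Gamma_zero:
  "gamma_system \<zeta> X (Gamma 0) n = ((\<lambda>x. veblen x 0) ^^ (n + 1)) 0"
  by (rule gamma_system_eqI) (rule gamma_val.Gamma_zero)

lemma gamma_system_Gamma:
  "0 < \<xi> \<Longrightarrow> \<xi> \<le> \<zeta> \<Longrightarrow>
    gamma_system \<zeta> X (Gamma \<xi>) n = ((\<lambda>x. veblen x 0) ^^ (n + 1)) (Gamma (X \<xi> n) + 1)"
  by (rule gamma_system_eqI) (rule gamma_val.Gamma)

section \<open>Fundamental sequences\<close>

lemma fundamental_sequence_iff:
  "fundamental_sequence \<alpha> s \<longleftrightarrow> mono s \<and> (\<forall>n. s n < \<alpha>) \<and> (\<forall>x<\<alpha>. \<exists>n. x \<le> s n)"
proof -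
  have "osup (range (\<lambda>n. s n + 1)) = \<alpha> \<longleftrightarrow> (\<forall>x. x < osup (range (\<lambda>n. s n + 1)) \<longleftrightarrow> x < \<alpha>)"
    by (metis linorder_neqE less_irrefl)
  also have "\<dots> \<longleftrightarrow> (\<forall>n. s n < \<alpha>) \<and> (\<forall>x<\<alpha>. \<exists>n. x \<le> s n)"
    by (auto simp: less_osup_range_iff intro: le_less_trans)
  finally show ?thesis
    by (simp add: fundamental_sequence_def)
qed

lemma funpow_le:
  fixes f g :: "'b::order \<Rightarrow> 'b"
  assumes "\<And>x y. x \<le> y \<Longrightarrow> f x \<le> g y" "\<And>x. x \<le> g x" "b \<le> c" "k \<le> m"
  shows "(f ^^ k) b \<le> (g ^^ m) c"
  using assms(4)
proof (induction m arbitrary: k)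
  case 0
  with assms(3) show ?case
    by simp
next
  case (Suc m)
  show ?case
  proof (cases k)
    case 0
    with Suc.IH[of 0] assms(2) show ?thesis
      using order_trans by fastforce
  next
    case (Suc k')
    with Suc.IH[of k'] Suc.prems assms(1) show ?thesis
      by simp
  qed
qed

lemma funpow_less:
  fixes f :: "'b::order \<Rightarrow> 'b"
  assumes "\<And>x. x < y \<Longrightarrow> f x < y" "b < y"
  shows "(f ^^ k) b < y"
  using assms by (induction k) auto

lemma funpow_veblen_le:
  "\<gamma> \<le> \<delta> \<Longrightarrow> b \<le> c \<Longrightarrow> k \<le> m \<Longrightarrow> (veblen \<gamma> ^^ k) b \<le> (veblen \<delta> ^^ m) (c :: 'a ordinal)"
  by (intro funpow_le) (simp_all add: veblen_mono)

lemma funpow_veblen_zero_le: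
  "b \<le> c \<Longrightarrow> k \<le> m \<Longrightarrow>
    ((\<lambda>x. veblen x 0) ^^ k) b \<le> ((\<lambda>x. veblen x 0) ^^ m) (c :: 'a ordinal)"
  by (intro funpow_le) simp_all

text \<open>Common core of the rules that iterate: function, start and number of iterations all grow
  with n. The supremum is fixed by every normal function lying below some \<open>f k\<close>,
  because each further index has one more application to spare.\<close>

lemma iterate_sup:
  fixes f :: "nat \<Rightarrow> 'a ordinal \<Rightarrow> 'a ordinal"
  assumes normal: "\<And>n. normal_fun (f n)"
    and mono: "\<And>m n x. m \<le> n \<Longrightarrow> f m x \<le> f n x"
    and "mono b" and less: "\<And>n. b n < f n (b n)"
  defines "s \<equiv> \<lambda>n. (f n ^^ (n + 1)) (b n)"
  shows iterate_sup_mono: "mono s"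
    and iterate_sup_less: "b n < osup (range s)"
    and iterate_sup_fixed: "normal_fun g \<Longrightarrow> (\<And>x. g x \<le> f k x) \<Longrightarrow> g (osup (range s)) = osup (range s)"
proof -
  have le: "(f m ^^ i) (b m) \<le> (f n ^^ j) (b n)" if "m \<le> n" "i \<le> j" for m n i j
  proof (rule funpow_le)
    show "f m x \<le> f n y" if "x \<le> y" for x y
      using mono[OF \<open>m \<le> n\<close>] normal_fun_strict_mono[OF normal, of n] that
      by (meson order_trans strict_mono_less_eq)
    show "x \<le> f n x" for x
      by (intro strict_mono_ordinal_le normal_fun_strict_mono normal)
    show "b m \<le> b n"
      using \<open>mono b\<close> \<open>m \<le> n\<close> by (rule monoD)
  qed fact
  then show mono_s: "mono s"
    by (intro monoI) (simp add: s_def del: funpow.simps)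
  have step: "(f n ^^ k) (b n) < (f n ^^ Suc k) (b n)" for n k
    by (induction k) (use less normal_fun_strict_mono[OF normal] in \<open>simp_all add: strict_mono_less\<close>)
  \<comment> \<open>Passing to index n + 1 does not lower the function or the start, and the
    additional application makes the increase strict.\<close>
  have s_less: "s n < s (Suc n)" for n
    using le_less_trans[OF le[OF le_SucI[OF order_refl] order_refl] step[where n = "Suc n" and k = "n + 1"]]
    by (simp add: s_def)
  let ?L = "osup (range s)"
  have s_L: "s n < ?L" for n
    using s_less by (auto simp: less_osup_range_iff)
  have "b n < s n"
    using le[of n n 1 "n + 1"] less[of n] by (simp add: s_def)
  then show "b n < ?L"
    using s_L less_trans by blast
  assume g: "normal_fun g" and g_le: "\<And>x. g x \<le> f k x"
  show "g ?L = ?L"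
  proof (rule normal_fun_fixed_limit[OF g])
    show "limit_ordinal ?L"
      using s_less by (rule limit_ordinal_osup)
    fix z assume "z < ?L"
    then obtain n where "z < s n"
      by (auto simp: less_osup_range_iff)
    \<comment> \<open>At this index the iterate has passed z, and the function dominates g.\<close>
    let ?m = "max n k"
    have "z \<le> s ?m"
      using \<open>z < s n\<close> monoD[OF mono_s, of n ?m] by simp
    have "g z \<le> f ?m z"
      using g_le[of z] mono[of k ?m z] by simp
    also have "\<dots> \<le> f ?m (s ?m)"
      using \<open>z \<le> s ?m\<close> normal_fun_strict_mono[OF normal] by (simp add: strict_mono_less_eq)
    also have "\<dots> = (f ?m ^^ (Suc ?m + 1)) (b ?m)"
      by (simp add: s_def)
    also have "\<dots> \<le> s (Suc ?m)"
      unfolding s_def by (rule le) (rule le_SucI, rule order_refl, rule order_refl)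
    also have "\<dots> < ?L"
      by (rule s_L)
    finally show "g z \<le> ?L"
      by simp
  qed
qed

text \<open>Since \<open>d\<close> is cofinal in \<delta>, the supremum is fixed by all functions of
  index below \<delta> and hence is a value of \<open>veblen \<delta>\<close>. The assumption
  \<open>least\<close> says that no value before \<open>veblen \<delta> \<beta>\<close> lies above
  all starts.\<close>

lemma fundamental_sequence_veblen:
  fixes \<delta> :: "'a ordinal"
  assumes "0 < \<delta>" "fundamental_sequence \<delta> d" "mono b"
    and b: "\<And>n. b n < veblen \<delta> \<beta>" "\<And>n. b n < veblen (d n) (b n)"
    and least: "\<And>\<theta>. (\<And>n. b n < veblen \<delta> \<theta>) \<Longrightarrow> \<beta> \<le> \<theta>"
  shows "fundamental_sequence (veblen \<delta> \<beta>) (\<lambda>n. (veblen (d n) ^^ (n + 1)) (b n))"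
proof -
  define s where "s = (\<lambda>n. (veblen (d n) ^^ (n + 1)) (b n))"
  have d: "mono d" "\<And>n. d n < \<delta>" "\<And>x. x < \<delta> \<Longrightarrow> \<exists>n. x \<le> d n"
    using assms(2) by (auto simp: fundamental_sequence_iff)
  note sup = iterate_sup[of "\<lambda>n. veblen (d n)" b, OF normal_fun_veblen _ assms(3) b(2),
      folded s_def]
  have mono: "veblen (d m) x \<le> veblen (d n) x" if "m \<le> n" for m n x
    using d(1) that by (simp add: monoD veblen_mono_left)
  have "s n < veblen \<delta> \<beta>" for n
    unfolding s_def
  proof (rule funpow_less)
    fix x assume "x < veblen \<delta> \<beta>"
    then have "veblen (d n) x < veblen (d n) (veblen \<delta> \<beta>)"
      by simp
    then show "veblen (d n) x < veblen \<delta> \<beta>"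
      using d(2) by (simp add: veblen_veblen)
  qed (rule b)
  moreover have "\<exists>n. x \<le> s n" if "x < veblen \<delta> \<beta>" for x
  proof -
    let ?L = "osup (range s)"
    have "veblen i ?L = ?L" if "i < \<delta>" for i
    proof -
      from d(3)[OF that] obtain k where k: "i \<le> d k" ..
      show ?thesis
        by (rule sup(3)[OF mono normal_fun_veblen veblen_mono_left[OF k]])
    qed
    then obtain \<theta> where \<theta>: "?L = veblen \<delta> \<theta>"
      using range_veblen[OF assms(1)] by blast
    have "\<beta> \<le> \<theta>"
      using sup(2)[OF mono] by (intro least) (simp add: \<theta>)
    then have "x < ?L"
      using that by (metis \<theta> less_le_trans veblen_le_iff)
    then show ?thesis
      by (auto simp: less_osup_range_iff dest: less_imp_le)
  qed
  ultimately show ?thesis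
    using sup(1)[OF mono] unfolding fundamental_sequence_iff s_def by blast
qed

lemma fundamental_sequence_Gamma:
  fixes \<xi> :: "'a ordinal"
  assumes "mono b" and b: "\<And>n. b n < Gamma \<xi>" "\<And>n. b n < veblen (b n) 0"
    and least: "\<And>\<theta>. (\<And>n. b n < Gamma \<theta>) \<Longrightarrow> \<xi> \<le> \<theta>"
  shows "fundamental_sequence (Gamma \<xi>) (\<lambda>n. ((\<lambda>x. veblen x 0) ^^ (n + 1)) (b n))"
proof -
  define s where "s = (\<lambda>n. ((\<lambda>x. veblen x 0) ^^ (n + 1)) (b n))"
  note sup = iterate_sup[of "\<lambda>_ x. veblen x 0" b, OF normal_fun_veblen_zero order_refl assms(1) b(2),
      folded s_def]
  have "s n < Gamma \<xi>" for n
    unfolding s_def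
  proof (rule funpow_less)
    fix x assume "x < Gamma \<xi>"
    then have "veblen x 0 < veblen (Gamma \<xi>) 0"
      by (subst veblen_zero_less_iff)
    then show "veblen x 0 < Gamma \<xi>"
      by simp
  qed (rule b)
  moreover have "\<exists>n. x \<le> s n" if "x < Gamma \<xi>" for x
  proof -
    let ?L = "osup (range s)"
    have "veblen ?L 0 = ?L"
      by (rule sup(3)[OF normal_fun_veblen_zero order_refl])
    then obtain \<theta> where \<theta>: "?L = Gamma \<theta>"
      using range_Gamma by blast
    have "\<xi> \<le> \<theta>"
      using sup(2) by (intro least) (simp add: \<theta>)
    then have "x < ?L"
      using that by (metis \<theta> less_le_trans Gamma_le_iff)
    then show ?thesis
      by (auto simp: less_osup_range_iff dest: less_imp_le)
  qed
  ultimately show ?thesis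
    using sup(1) unfolding fundamental_sequence_iff s_def by blast
qed

lemma Gamma_succ_less_veblen_zero: "Gamma \<xi> + 1 < (veblen (Gamma \<xi> + 1) 0 :: 'a ordinal)"
  by (metis Gamma_eq_omega_pow Gamma_pos less_veblen_zero_iff omega_pow_ne_succ)

lemma fundamental_systemD:
  assumes "fundamental_system \<Gamma> F" "\<alpha> \<le> \<Gamma>" "0 < \<alpha>"
  shows "mono (F \<alpha>)" "F \<alpha> n < \<alpha>" "x < \<alpha> \<Longrightarrow> \<exists>n. x \<le> F \<alpha> n"
  using assms by (auto simp: fundamental_system_def fundamental_sequence_iff)

text \<open>For \<delta> > 0 the value is \<omega> raised to itself, hence greater than 1 and closed
  under addition.\<close>

lemma succ_less_veblen:
  assumes "0 < \<delta>" "\<alpha> < veblen \<delta> (\<beta> :: 'a ordinal)"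
  shows "\<alpha> + 1 < veblen \<delta> \<beta>"
proof -
  have "0 < veblen \<delta> \<beta>"
    by simp
  have "\<alpha> + 1 < omega_pow (veblen \<delta> \<beta>)"
  proof (rule add_less_omega_pow)
    show "\<alpha> < omega_pow (veblen \<delta> \<beta>)" "1 < omega_pow (veblen \<delta> \<beta>)"
      using assms omega_pow_less[of 0 "veblen \<delta> \<beta>"] by (simp_all add: omega_pow_veblen)
  qed
  then show ?thesis
    using assms by (simp add: omega_pow_veblen)
qed

lemma fundamental_sequence_gamma_system:
  assumes X: "fundamental_system \<zeta> X"
  shows "0 < \<alpha> \<Longrightarrow> \<alpha> \<le> Gamma \<zeta> \<Longrightarrow> fundamental_sequence \<alpha> (gamma_system \<zeta> X \<alpha>)"
proof (induction \<alpha> rule: less_induct)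
  case (less \<alpha>)
  let ?F = "gamma_system \<zeta> X"
  have IH: "fundamental_sequence \<beta> (?F \<beta>)" if "\<beta> < \<alpha>" "0 < \<beta>" for \<beta>
    using less.IH[of \<beta>] less.prems that by simp
  from less.prems(1) show ?case
  proof (cases rule: ordinal_shape_cases)
    case (sum \<tau> a)
    have "omega_pow a < \<alpha>"
      using exponents_ge_omega_pow_le[OF sum(2,1)] le_less_trans by (fastforce simp: sum)
    from IH[OF this] have a: "mono (?F (omega_pow a))" "\<And>n. ?F (omega_pow a) n < omega_pow a"
        "\<And>x. x < omega_pow a \<Longrightarrow> \<exists>n. x \<le> ?F (omega_pow a) n"
      by (auto simp: fundamental_sequence_iff)
    have eq: "?F \<alpha> n = \<tau> + ?F (omega_pow a) n" for n
      using less.prems(2) sum by (simp add: gamma_system_sum)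
    have "\<exists>n. x \<le> ?F \<alpha> n" if "x < \<alpha>" for x
    proof (cases "x \<le> \<tau>")
      case True
      then show ?thesis
        using eq ordinal_le_add_left order_trans by metis
    next
      case False
      then obtain \<rho> where \<rho>: "x = \<tau> + \<rho>"
        by (meson nle_le ordinal_le_obtain_add)
      with that have "\<rho> < omega_pow a"
        by (simp add: sum)
      with a(3) show ?thesis
        by (simp add: eq \<rho>)
    qed
    then show ?thesis
      using a by (auto simp: fundamental_sequence_iff eq mono_def) (simp add: sum)
  next
    case one
    then show ?thesis
      by (simp add: fundamental_sequence_iff mono_def)
  next
    case (omega_pow a)
    from IH[of a] omega_pow have a: "mono (?F a)" "\<And>n. ?F a n < a" "\<And>x. x < a \<Longrightarrow> \<exists>n. x \<le> ?F a n"
      by (auto simp: fundamental_sequence_iff)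
    have eq: "?F \<alpha> n = omega_pow (?F a n) * ord_of_nat n" for n
      using less.prems(2) omega_pow by (simp add: gamma_system_omega_pow)
    have "mono (?F \<alpha>)"
      unfolding eq using a(1) by (intro monoI ordinal_mult_ord_of_nat_mono) (auto simp: eq dest: monoD)
    moreover have "?F \<alpha> n < \<alpha>" for n
      using omega_pow_mult_ord_of_nat_less[OF a(2)] by (simp only: eq flip: omega_pow(3))
    moreover have "\<exists>n. x \<le> ?F \<alpha> n" if "x < \<alpha>" for x
    proof -
      have "x < omega_pow a"
        using that omega_pow(3) by simp
      from less_omega_powE[OF this omega_pow(1)]
      obtain b m where b: "b < a" "x < omega_pow b * ord_of_nat m" .
      obtain k where "b \<le> ?F a k"
        using a(3)[OF b(1)] ..
      \<comment> \<open>Exponent and factor of a member depend on the same index, which must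
        therefore be at least k and at least m.\<close>
      then have "b \<le> ?F a (max k m)"
        using monoD[OF a(1), of k "max k m"] by simp
      then have "omega_pow b * ord_of_nat m \<le> ?F \<alpha> (max k m)"
        unfolding eq by (intro ordinal_mult_ord_of_nat_mono) simp_all
      with b(2) show ?thesis
        by (intro exI[of _ "max k m"]) simp
    qed
    ultimately show ?thesis
      by (simp add: fundamental_sequence_iff)
  next
    case (veblen \<delta> \<beta>)
    have d: "fundamental_sequence \<delta> (?F \<delta>)"
      using IH veblen by simp
    show ?thesis
    proof (cases "\<beta> = 0")
      case True
      have "?F \<alpha> = (\<lambda>n. (veblen (?F \<delta> n) ^^ (n + 1)) 0)"
        using veblen less.prems(2) True gamma_system_veblen_zero by blast
      with fundamental_sequence_veblen[OF veblen(1) d, of "\<lambda>_. 0" \<beta>] veblen(4) show ?thesis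
        by (simp add: mono_def True)
    next
      case False
      then have "0 < \<beta>"
        by (simp add: ordinal_pos_iff)
      have b: "mono (?F \<beta>)" "\<And>n. ?F \<beta> n < \<beta>" "\<And>x. x < \<beta> \<Longrightarrow> \<exists>n. x \<le> ?F \<beta> n"
        using IH[of \<beta>] veblen \<open>0 < \<beta>\<close> by (auto simp: fundamental_sequence_iff)
      have eq: "?F \<alpha> = (\<lambda>n. (veblen (?F \<delta> n) ^^ (n + 1)) (veblen \<delta> (?F \<beta> n) + 1))"
        using veblen less.prems(2) \<open>0 < \<beta>\<close> gamma_system_veblen by blast
      have "fundamental_sequence (veblen \<delta> \<beta>)
          (\<lambda>n. (veblen (?F \<delta> n) ^^ (n + 1)) (veblen \<delta> (?F \<beta> n) + 1))"
      proof (rule fundamental_sequence_veblen[OF veblen(1) d])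
        show "mono (\<lambda>n. veblen \<delta> (?F \<beta> n) + 1)"
          using b(1) by (simp add: mono_def ordinal_add_mono_left del: ordinal_succ_le_iff)
        show "veblen \<delta> (?F \<beta> n) + 1 < veblen \<delta> \<beta>" for n
          using veblen(1) b(2) by (intro succ_less_veblen) simp_all
        show "veblen \<delta> (?F \<beta> n) + 1 < veblen (?F \<delta> n) (veblen \<delta> (?F \<beta> n) + 1)" for n
          by (rule less_veblen_succ) simp
        fix \<theta> assume \<theta>: "\<And>n. veblen \<delta> (?F \<beta> n) + 1 < veblen \<delta> \<theta>"
        have "?F \<beta> n < \<theta>" for n
          using \<theta>[of n] by (metis less_trans ordinal_less_succ_iff order_refl veblen_less_iff)
        with b(3) show "\<beta> \<le> \<theta>"
          by (meson le_less_trans less_irrefl not_le)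
      qed
      then show ?thesis
        by (simp only: eq flip: veblen(4))
    qed
  next
    case (Gamma \<xi>)
    with less.prems(2) have "\<xi> \<le> \<zeta>"
      by simp
    show ?thesis
    proof (cases "\<xi> = 0")
      case True
      have "?F \<alpha> = (\<lambda>n. ((\<lambda>x. veblen x 0) ^^ (n + 1)) 0)"
        using Gamma True gamma_system_Gamma_zero by blast
      with fundamental_sequence_Gamma[of "\<lambda>_. 0" \<xi>] Gamma show ?thesis
        by (simp add: mono_def True)
    next
      case False
      then have "0 < \<xi>"
        by (simp add: ordinal_pos_iff)
      have eq: "?F \<alpha> = (\<lambda>n. ((\<lambda>x. veblen x 0) ^^ (n + 1)) (Gamma (X \<xi> n) + 1))"
        using Gamma \<open>\<xi> \<le> \<zeta>\<close> \<open>0 < \<xi>\<close> gamma_system_Gamma by blast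
      note b = fundamental_systemD[OF X \<open>\<xi> \<le> \<zeta>\<close> \<open>0 < \<xi>\<close>]
      have "fundamental_sequence (Gamma \<xi>)
          (\<lambda>n. ((\<lambda>x. veblen x 0) ^^ (n + 1)) (Gamma (X \<xi> n) + 1))"
      proof (rule fundamental_sequence_Gamma)
        show "mono (\<lambda>n. Gamma (X \<xi> n) + 1)"
          using b(1) by (simp add: mono_def ordinal_add_mono_left del: ordinal_succ_le_iff)
        show "Gamma (X \<xi> n) + 1 < Gamma \<xi>" for n
          using b(2)[of n] succ_less_veblen[of "Gamma \<xi>" "Gamma (X \<xi> n)" 0] by simp
        show "Gamma (X \<xi> n) + 1 < veblen (Gamma (X \<xi> n) + 1) 0" for n
          by (rule Gamma_succ_less_veblen_zero)
        fix \<theta> assume \<theta>: "\<And>n. Gamma (X \<xi> n) + 1 < Gamma \<theta>"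
        have "X \<xi> n < \<theta>" for n
          using \<theta>[of n] by (metis less_trans ordinal_less_succ_iff order_refl Gamma_less_iff)
        with b(3) show "\<xi> \<le> \<theta>"
          by (meson le_less_trans less_irrefl not_le)
      qed
      then show ?thesis
        by (simp only: eq flip: Gamma)
    qed
  qed
qed

lemma fundamental_system_gamma_system:
  "fundamental_system \<zeta> X \<Longrightarrow> fundamental_system (Gamma \<zeta>) (gamma_system \<zeta> X)"
  using fundamental_sequence_gamma_system by (auto simp: fundamental_system_def[of "Gamma \<zeta>"])

section \<open>Nestedness\<close>

text \<open>The last term of \<tau> + \<rho> is that of \<rho>, so only \<rho> is affected. This
  reduces the comparison of two ordinals with a common head to their tails.\<close>

lemma gamma_system_add:
  assumes "0 < \<tau>" "exponents_ge a \<tau>" "0 < \<rho>" "\<rho> < omega_pow a" "\<tau> + \<rho> \<le> Gamma \<zeta>"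
  shows "gamma_system \<zeta> X (\<tau> + \<rho>) n = \<tau> + gamma_system \<zeta> X \<rho> n"
proof -
  obtain \<sigma> e where \<sigma>: "exponents_ge e \<sigma>" "\<rho> = \<sigma> + omega_pow e"
    using ordinal_decomposition[OF assms(3)] .
  have "omega_pow e < omega_pow a"
    using assms(4) \<sigma>(2) by (metis le_less_trans ordinal_le_add_right)
  then have "e \<le> a"
    by (simp add: less_imp_le)
  then have ex: "exponents_ge e (\<tau> + \<sigma>)"
    using assms(2) \<sigma>(1) by (intro exponents_ge_add)
  have "0 < \<tau> + \<sigma>"
    using assms(1) ordinal_le_add_left less_le_trans by blast
  then have *: "gamma_system \<zeta> X (\<tau> + \<rho>) n = \<tau> + (\<sigma> + gamma_system \<zeta> X (omega_pow e) n)"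
    using gamma_system_sum[OF _ ex, of \<zeta> X n] assms(5) by (simp add: \<sigma>(2) ordinal_add_assoc)
  show ?thesis
  proof (cases "\<sigma> = 0")
    case True
    with * show ?thesis
      by (simp add: \<sigma>(2))
  next
    case False
    have "\<rho> \<le> Gamma \<zeta>"
      using assms(5) ordinal_le_add_right order_trans by blast
    with False \<sigma> have "gamma_system \<zeta> X \<rho> n = \<sigma> + gamma_system \<zeta> X (omega_pow e) n"
      by (simp add: gamma_system_sum ordinal_pos_iff)
    with * show ?thesis
      by simp
  qed
qed

lemma omega_pow_le_head:
  "exponents_ge a \<tau> \<Longrightarrow> 0 < \<tau> \<Longrightarrow> omega_pow e < \<tau> + omega_pow a \<Longrightarrow> omega_pow e \<le> \<tau>"
  using omega_pow_mult_le_head[of a \<tau> e 1] by simp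

lemma left_le_if_not_fixed:
  "veblen \<delta> \<beta> < veblen \<mu> (veblen \<delta> \<beta>) \<Longrightarrow> \<delta> \<le> (\<mu> :: 'a ordinal)"
  by (metis less_irrefl not_le veblen_veblen)

text \<open>Every ordinal between a fixed point of \<open>veblen \<mu>\<close> and the next one is built by operations
  under which that fixed point is closed, so one of its components is still above it.\<close>

lemma above_fixed_point_cases [consumes 3, case_names sum omega_pow veblen]:
  fixes \<eta> :: "'a ordinal"
  assumes "veblen \<mu> x = x" "x < \<eta>" "\<eta> < veblen \<mu> \<eta>"
  obtains \<tau> a where "0 < \<tau>" "exponents_ge a \<tau>" "\<eta> = \<tau> + omega_pow a" "x \<le> \<tau>"
  | a where "0 < a" "a < omega_pow a" "\<eta> = omega_pow a" "x < a" "a < veblen \<mu> a"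
  | \<delta> \<beta> where "0 < \<delta>" "\<delta> < veblen \<delta> \<beta>" "\<beta> < veblen \<delta> \<beta>" "\<eta> = veblen \<delta> \<beta>"
      "\<delta> \<le> \<mu>" "x < \<beta>" "\<beta> < veblen \<mu> \<beta>"
proof -
  have x: "omega_pow x = x" "0 < x"
    using assms(1) veblen_fixed_omega_pow veblen_fixed_pos by blast+
  have "0 < \<eta>"
    using assms(2) by (rule le_less_trans[OF ordinal_zero_le])
  then show thesis
  proof (cases rule: ordinal_shape_cases)
    case (sum \<tau> a)
    have "omega_pow x \<le> \<tau>"
      using sum assms(2) x(1) by (intro omega_pow_le_head) simp_all
    with sum x(1) that(1) show thesis
      by simp
  next
    case one
    with assms(2) x(2) show thesis
      by simp
  next
    case (omega_pow a)
    then have "omega_pow x < omega_pow a"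
      using assms(2) x(1) by simp
    moreover have "a < veblen \<mu> a"
      using omega_pow(2) veblen_fixed_omega_pow less_veblen_iff by (metis less_irrefl)
    ultimately show thesis
      using omega_pow that(2) by simp
  next
    case (veblen \<delta> \<beta>)
    have \<delta>: "\<delta> \<le> \<mu>"
      using assms(3) unfolding veblen(4) by (rule left_le_if_not_fixed)
    have "veblen \<delta> x = x"
      using assms(1) \<delta> by (rule veblen_fixed_antimono)
    then have "x < \<beta>"
      using assms(2) veblen(4) by (metis veblen_less_iff)
    moreover have "\<beta> < veblen \<mu> \<beta>"
      using veblen(3) \<delta> veblen_fixed_antimono less_veblen_iff by (metis less_irrefl)
    ultimately show thesis
      using veblen \<delta> that(3) by simp
  next
    case (Gamma \<xi>)
    \<comment> \<open>This shape is impossible: such an \<eta> not fixed by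
      \<open>veblen \<mu>\<close> is at most \<mu>, and \<mu> is at most its value
      \<open>veblen \<mu> x\<close>, which is x.\<close>
    then have "Gamma \<xi> \<le> \<mu>"
      using assms(3) by (metis less_irrefl not_le veblen_Gamma)
    also have "\<mu> \<le> x"
      using assms(1) by (metis left_le_veblen)
    finally show thesis
      using assms(2) Gamma by simp
  qed
qed

text \<open>The last property compares indices: if \<open>veblen i\<close> with \<nu> \<le> i fixed
  \<eta>, so would \<open>veblen \<nu>\<close>, and injectivity would give \<theta> =
  \<eta>.\<close>

lemma fixed_point_cases:
  fixes \<eta> :: "'a ordinal"
  assumes "omega_pow \<eta> = \<eta>" "\<eta> < veblen \<eta> 0"
  obtains \<nu> \<theta> where "0 < \<nu>" "\<nu> < veblen \<nu> \<theta>" "\<theta> < veblen \<nu> \<theta>" "\<eta> = veblen \<nu> \<theta>"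
    "\<And>i. veblen i \<eta> = \<eta> \<Longrightarrow> i < \<nu>"
  using assms(1)
proof (cases rule: omega_pow_fixed_cases)
  case (1 \<nu> \<theta>)
  have "i < \<nu>" if "veblen i \<eta> = \<eta>" for i
    using 1 that veblen_fixed_antimono[of i \<eta> \<nu>] by (metis less_irrefl not_le veblen_eq_iff)
  with 1 that show thesis
    by blast
next
  case (2 \<xi>)
  with assms(2) show thesis
    by simp
qed

lemma gamma_system_omega_pow_ge:
  assumes "0 < a" "a < omega_pow a" "omega_pow a \<le> Gamma \<zeta>" "0 < n" "x \<le> gamma_system \<zeta> X a n"
  shows "omega_pow x \<le> gamma_system \<zeta> X (omega_pow a) n"
  using assms ordinal_mult_ord_of_nat_mono[of "omega_pow x" "omega_pow (gamma_system \<zeta> X a n)" 1 n]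
  by (simp add: gamma_system_omega_pow)

text \<open>The start of the iteration in the two Veblen rules, with \<open>\<beta>'\<close>
  standing for \<beta>[n]; one expression lets ordinals falling under different rules be
  compared.\<close>

definition veblen_base :: "'a ordinal \<Rightarrow> 'a ordinal \<Rightarrow> 'a ordinal \<Rightarrow> 'a ordinal" where
  "veblen_base \<delta> \<beta> \<beta>' = (if \<beta> = 0 then 0 else veblen \<delta> \<beta>' + 1)"

lemma veblen_base_simps [simp]:
  "veblen_base \<delta> 0 \<beta>' = 0"
  "0 < \<beta> \<Longrightarrow> veblen_base \<delta> \<beta> \<beta>' = veblen \<delta> \<beta>' + 1"
  by (auto simp: veblen_base_def)

lemma gamma_system_veblen_eq:
  assumes "0 < \<delta>" "\<delta> < veblen \<delta> \<beta>" "\<beta> < veblen \<delta> \<beta>" "veblen \<delta> \<beta> \<le> Gamma \<zeta>"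
  shows "gamma_system \<zeta> X (veblen \<delta> \<beta>) n = (veblen (gamma_system \<zeta> X \<delta> n) ^^ (n + 1))
    (veblen_base \<delta> \<beta> (gamma_system \<zeta> X \<beta> n))"
  using assms gamma_system_veblen_zero[of \<delta> \<zeta> X n] gamma_system_veblen[of \<beta> \<delta> \<zeta> X n]
  by (cases "\<beta> = 0") (auto simp: ordinal_pos_iff)

text \<open>Index, number of iterations and start may all be lowered. Later bounds use zero, one,
  two or all n + 1 iterations.\<close>

lemma gamma_system_veblen_ge:
  assumes "0 < \<delta>" "\<delta> < veblen \<delta> \<beta>" "\<beta> < veblen \<delta> \<beta>" "veblen \<delta> \<beta> \<le> Gamma \<zeta>"
  shows "\<mu> \<le> gamma_system \<zeta> X \<delta> n \<Longrightarrow> k \<le> n + 1 \<Longrightarrow>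
      b \<le> veblen_base \<delta> \<beta> (gamma_system \<zeta> X \<beta> n) \<Longrightarrow>
      (veblen \<mu> ^^ k) b \<le> gamma_system \<zeta> X (veblen \<delta> \<beta>) n"
    and "0 < \<beta> \<Longrightarrow> x \<le> gamma_system \<zeta> X \<beta> n \<Longrightarrow>
      veblen \<delta> x + 1 \<le> gamma_system \<zeta> X (veblen \<delta> \<beta>) n"
proof -
  show 1: "(veblen \<mu> ^^ k) b \<le> gamma_system \<zeta> X (veblen \<delta> \<beta>) n"
    if "\<mu> \<le> gamma_system \<zeta> X \<delta> n" "k \<le> n + 1"
      "b \<le> veblen_base \<delta> \<beta> (gamma_system \<zeta> X \<beta> n)" for \<mu> k b
    unfolding gamma_system_veblen_eq[OF assms] using that by (intro funpow_veblen_le)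
  assume "0 < \<beta>" "x \<le> gamma_system \<zeta> X \<beta> n"
  then have "veblen \<delta> x + 1 \<le> veblen_base \<delta> \<beta> (gamma_system \<zeta> X \<beta> n)"
    by simp
  \<comment> \<open>With no iterations the index is irrelevant, so 0 serves.\<close>
  with 1[of 0 0 "veblen \<delta> x + 1"] show "veblen \<delta> x + 1 \<le> gamma_system \<zeta> X (veblen \<delta> \<beta>) n"
    by (simp del: ordinal_succ_le_iff)
qed

text \<open>A positive n matters because the rule for \<open>omega_pow\<close> multiplies by n. The
  bound supplies the missing unit when the head of a sum is exactly a fixed point.\<close>

lemma gamma_system_pos:
  assumes X: "fundamental_system \<zeta> X" and "1 < \<alpha>" "\<alpha> \<le> Gamma \<zeta>" "0 < n"
  shows "0 < gamma_system \<zeta> X \<alpha> n"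
proof -
  have "0 < \<alpha>"
    using assms(2) less_trans ordinal_one(1) by blast
  then show ?thesis
  proof (cases rule: ordinal_shape_cases)
    case (sum \<tau> a)
    then show ?thesis
      using assms(3) ordinal_le_add_left less_le_trans by (metis gamma_system_sum)
  next
    case one
    with assms(2) show ?thesis
      by simp
  next
    case (omega_pow a)
    then show ?thesis
      using assms gamma_system_omega_pow_ge[of a \<zeta> n 0 X] by simp
  next
    case (veblen \<delta> \<beta>)
    then show ?thesis
      using assms(3) by (simp add: gamma_system_veblen_eq)
  next
    case (Gamma \<xi>)
    then show ?thesis
      using assms(3) by (cases "\<xi> = 0")
        (simp_all add: gamma_system_Gamma_zero gamma_system_Gamma ordinal_pos_iff veblen_pos[unfolded ordinal_pos_iff])
  qed
qed

text \<open>The property that drives the proof: below the next fixed point of a function \<open>f\<close> (which is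
  \<open>veblen \<mu>\<close> or \<open>\<lambda>x. veblen x 0\<close>), fundamental sequences of ordinals above \<open>b\<close> do not jump
  below \<open>b\<close> at index \<open>n\<close>. It is preserved when \<open>f\<close> is applied to \<open>b\<close>, hence passes from
  the start of the iteration in the rules for \<open>\<beta>[n]\<close> to \<open>\<beta>[n]\<close> itself.\<close>

definition barrier ::
  "'a ordinal \<Rightarrow> ('a ordinal \<Rightarrow> nat \<Rightarrow> 'a ordinal) \<Rightarrow> nat \<Rightarrow> ('a ordinal \<Rightarrow> 'a ordinal) \<Rightarrow>
    'a ordinal \<Rightarrow> bool" where
  "barrier \<zeta> X n f b \<longleftrightarrow>
    (\<forall>\<eta>\<le>Gamma \<zeta>. b < \<eta> \<longrightarrow> \<eta> < f \<eta> \<longrightarrow> b \<le> gamma_system \<zeta> X \<eta> n)"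

lemma barrierD:
  "barrier \<zeta> X n f b \<Longrightarrow> b < \<eta> \<Longrightarrow> \<eta> < f \<eta> \<Longrightarrow> \<eta> \<le> Gamma \<zeta> \<Longrightarrow> b \<le> gamma_system \<zeta> X \<eta> n"
  by (simp add: barrier_def)

lemma barrier_zero: "barrier \<zeta> X n f 0"
  by (simp add: barrier_def)

lemma barrier_funpow:
  assumes "\<And>b. barrier \<zeta> X n f b \<Longrightarrow> barrier \<zeta> X n f (f b)" "barrier \<zeta> X n f b"
  shows "barrier \<zeta> X n f ((f ^^ k) b)"
  using assms by (induction k) auto

text \<open>A head of a sum is kept by its members. In the other shapes the component above x is
  again not fixed by \<open>veblen \<mu>\<close>, so induction bounds its member by x, and the outer
  operation applied to x gives back x.\<close>

lemma barrier_fixed_point: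
  assumes "0 < n" "veblen \<mu> x = x"
  shows "barrier \<zeta> X n (veblen \<mu>) x"
proof -
  have "x \<le> gamma_system \<zeta> X \<eta> n" if "\<eta> \<le> Gamma \<zeta>" "x < \<eta>" "\<eta> < veblen \<mu> \<eta>" for \<eta>
    using that
  proof (induction \<eta> rule: less_induct)
    case (less \<eta>)
    from assms(2) less.prems(2,3) show ?case
    proof (cases rule: above_fixed_point_cases)
      case (sum \<tau> a)
      with less.prems(1) have "gamma_system \<zeta> X \<eta> n = \<tau> + gamma_system \<zeta> X (omega_pow a) n"
        by (simp add: gamma_system_sum)
      with order_trans[OF sum(4) ordinal_le_add_left] show ?thesis
        by simp
    next
      case (omega_pow a)
      then have "x \<le> gamma_system \<zeta> X a n"
        using less by simp
      then have "omega_pow x \<le> gamma_system \<zeta> X \<eta> n"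
        using omega_pow(1-3) less.prems(1) assms(1) gamma_system_omega_pow_ge by metis
      with assms(2) show ?thesis
        by (simp add: veblen_fixed_omega_pow)
    next
      case (veblen \<delta> \<beta>)
      then have "x \<le> gamma_system \<zeta> X \<beta> n"
        using less by simp
      moreover have "0 < \<beta>"
        using veblen(6) by (rule le_less_trans[OF ordinal_zero_le])
      ultimately have "veblen \<delta> x + 1 \<le> gamma_system \<zeta> X \<eta> n"
        using veblen(1-4) less.prems(1) gamma_system_veblen_ge(2) by metis
      then show ?thesis
        by (meson le_veblen less_imp_le order_trans ordinal_succ_le_iff)
    qed
  qed
  then show ?thesis
    by (simp add: barrier_def)
qed

text \<open>Refines the bound x of \<open>barrier_fixed_point\<close> by one. The extra unit comes
  from the last term of a sum, from the factor n > 1 in a power, or from the successor in the start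
  of a Veblen iteration.\<close>

lemma barrier_fixed_point_succ:
  assumes "fundamental_system \<zeta> X" "1 < n" "veblen \<mu> x = x"
  shows "barrier \<zeta> X n (veblen \<mu>) (x + 1)"
  unfolding barrier_def
proof (intro allI impI)
  fix \<eta> assume \<eta>: "\<eta> \<le> Gamma \<zeta>" "x + 1 < \<eta>" "\<eta> < veblen \<mu> \<eta>"
  have "0 < n" "0 < x"
    using assms veblen_fixed_pos by auto
  note barrier = barrierD[OF barrier_fixed_point[OF \<open>0 < n\<close> assms(3)]]
  have "x < \<eta>"
    using \<eta>(2) by (meson less_trans ordinal_less_succ_iff order_refl)
  from assms(3) this \<eta>(3) show "x + 1 \<le> gamma_system \<zeta> X \<eta> n"
  proof (cases rule: above_fixed_point_cases)
    case (sum \<tau> a)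
    have eq: "gamma_system \<zeta> X \<eta> n = \<tau> + gamma_system \<zeta> X (omega_pow a) n"
      using sum \<eta>(1) gamma_system_sum by blast
    show ?thesis
    proof (cases "x = \<tau>")
      case True
      \<comment> \<open>The head alone is one short here, but \<eta> > x + 1 makes the last term
        exceed 1, so its member is positive.\<close>
      then have "1 < omega_pow a"
        using sum \<eta>(2) by simp
      moreover have "omega_pow a \<le> Gamma \<zeta>"
        using sum \<eta>(1) by (metis ordinal_le_add_right order_trans)
      ultimately have "0 < gamma_system \<zeta> X (omega_pow a) n"
        using assms(1) \<open>0 < n\<close> by (intro gamma_system_pos)
      with True show ?thesis
        by (simp add: eq)
    next
      case False
      with sum(4) have "x < \<tau>"
        by simp
      then show ?thesis
        by (simp add: eq less_le_trans)
    qed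
  next
    case (omega_pow a)
    then have "x \<le> gamma_system \<zeta> X a n"
      using \<eta>(1) by (intro barrier) simp_all
    \<comment> \<open>This is where n > 1 enters: two copies of x exceed x, whereas one copy would
      just be x.\<close>
    then have "omega_pow x * ord_of_nat 2 \<le> gamma_system \<zeta> X \<eta> n"
      unfolding omega_pow(3) using omega_pow(1-3) \<eta>(1) assms(2)
      by (subst gamma_system_omega_pow) (auto intro!: ordinal_mult_ord_of_nat_mono)
    then have "x + x \<le> gamma_system \<zeta> X \<eta> n"
      using ordinal_mult_ord_of_nat_add[of "omega_pow x" 1 1] veblen_fixed_omega_pow[OF assms(3)]
      by (simp add: numeral_2_eq_2)
    then show ?thesis
      using \<open>0 < x\<close> by (meson less_le_trans ordinal_less_add_left ordinal_succ_le_iff)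
  next
    case (veblen \<delta> \<beta>)
    then have "x \<le> gamma_system \<zeta> X \<beta> n"
      using \<eta>(1) by (intro barrier) simp_all
    moreover have "0 < \<beta>"
      using veblen(6) by (rule le_less_trans[OF ordinal_zero_le])
    ultimately have "veblen \<delta> x + 1 \<le> gamma_system \<zeta> X \<eta> n"
      using veblen(1-4) \<eta>(1) gamma_system_veblen_ge(2) by metis
    then show ?thesis
      by (meson le_veblen le_less_trans ordinal_succ_le_iff)
  qed
qed

text \<open>The value \<open>veblen \<mu> b\<close> is fixed by all functions of smaller index, so
  any \<eta> moved by one of these is covered by \<open>barrier_fixed_point\<close>. Apart from
  sums, there remains an \<eta> of outermost index \<mu>, whose argument exceeds b and falls under
  the assumption.\<close>

lemma barrier_veblen:
  assumes "0 < n" "barrier \<zeta> X n (veblen \<mu>) b"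
  shows "barrier \<zeta> X n (veblen \<mu>) (veblen \<mu> b)"
  unfolding barrier_def
proof (intro allI impI)
  fix \<eta> assume \<eta>: "\<eta> \<le> Gamma \<zeta>" "veblen \<mu> b < \<eta>" "\<eta> < veblen \<mu> \<eta>"
  have lower: "veblen \<mu> b \<le> gamma_system \<zeta> X \<eta> n" if "\<delta> < \<mu>" "\<eta> < veblen \<delta> \<eta>" for \<delta>
    using barrierD[OF barrier_fixed_point[OF assms(1) veblen_veblen[OF that(1), of b]]] that(2) \<eta>
    by blast
  have "0 < \<eta>"
    using \<eta>(2) by (rule le_less_trans[OF ordinal_zero_le])
  then show "veblen \<mu> b \<le> gamma_system \<zeta> X \<eta> n"
  proof (cases rule: ordinal_shape_cases)
    case (sum \<tau> a)
    obtain e where "veblen \<mu> b = omega_pow e"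
      using veblen_eq_omega_pow by blast
    with sum \<eta>(2) have "veblen \<mu> b \<le> \<tau>"
      by (metis omega_pow_le_head)
    then show ?thesis
      using sum \<eta>(1) by (metis gamma_system_sum ordinal_le_add_left order_trans)
  next
    case one
    with \<eta>(2) veblen_pos[of \<mu> b] show ?thesis
      by simp
  next
    case (omega_pow a)
    show ?thesis
    proof (cases "\<mu> = 0")
      case True
      with omega_pow \<eta> have "b \<le> gamma_system \<zeta> X a n"
        by (intro barrierD[OF assms(2)]) (simp_all add: veblen_zero_left)
      with True omega_pow \<eta>(1) assms(1) show ?thesis
        using gamma_system_omega_pow_ge by (metis veblen_zero_left)
    next
      case False
      with omega_pow show ?thesis
        by (intro lower[of 0]) (simp_all add: ordinal_pos_iff veblen_zero_left)
    qed
  next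
    case (veblen \<delta> \<beta>)
    have "\<delta> \<le> \<mu>"
      using \<eta>(3) unfolding veblen(4) by (rule left_le_if_not_fixed)
    show ?thesis
    proof (cases "\<delta> = \<mu>")
      case True
      with veblen \<eta> have "b < \<beta>"
        by simp
      with True veblen \<eta>(1) have "b \<le> gamma_system \<zeta> X \<beta> n"
        by (intro barrierD[OF assms(2)]) simp_all
      moreover have "0 < \<beta>"
        using \<open>b < \<beta>\<close> by (rule le_less_trans[OF ordinal_zero_le])
      ultimately have "veblen \<delta> b + 1 \<le> gamma_system \<zeta> X \<eta> n"
        using veblen \<eta>(1) gamma_system_veblen_ge(2) by metis
      with True show ?thesis
        by simp
    next
      case False
      with \<open>\<delta> \<le> \<mu>\<close> veblen show ?thesis
        by (intro lower[of \<delta>]) simp_all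
    qed
  next
    case (Gamma \<xi>)
    then have "Gamma \<xi> \<le> \<mu>"
      using \<eta>(3) by (metis less_irrefl not_le veblen_Gamma)
    also have "\<mu> \<le> veblen \<mu> b"
      by simp
    finally show ?thesis
      using \<eta>(2) Gamma by simp
  qed
qed

text \<open>If some index below \<open>?g\<close> moves \<eta>, then \<open>?g\<close> is a fixed
  point for that index and \<open>barrier_fixed_point\<close> applies. Otherwise the outermost index
  \<nu> of \<eta> is at least \<open>?g\<close>, and induction passes from \<eta> to \<nu> when the
  argument is 0.\<close>

lemma barrier_Gamma:
  assumes "0 < n"
  shows "barrier \<zeta> X n (\<lambda>x. veblen x 0) (Gamma \<xi>)"
proof -
  let ?g = "Gamma \<xi>"
  have "?g \<le> gamma_system \<zeta> X \<eta> n" if "\<eta> \<le> Gamma \<zeta>" "?g < \<eta>" "\<eta> < veblen \<eta> 0" for \<eta>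
    using that
  proof (induction \<eta> rule: less_induct)
    case (less \<eta>)
    show ?case
    proof (cases "\<exists>i<?g. \<eta> < veblen i \<eta>")
      case True
      then show ?thesis
        using barrier_fixed_point[OF assms veblen_Gamma] less.prems barrierD by metis
    next
      case False
      then have fixed: "veblen i \<eta> = \<eta>" if "i < ?g" for i
        using that less_veblen_iff by blast
      with Gamma_pos have "omega_pow \<eta> = \<eta>"
        using veblen_zero_left by metis
      from this less.prems(3) obtain \<nu> \<theta> where \<nu>: "0 < \<nu>" "\<nu> < veblen \<nu> \<theta>" "\<theta> < veblen \<nu> \<theta>"
          "\<eta> = veblen \<nu> \<theta>" "\<And>i. veblen i \<eta> = \<eta> \<Longrightarrow> i < \<nu>"
        by (rule fixed_point_cases) blast
      have "?g \<le> \<nu>"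
        using fixed \<nu>(5) by (meson less_irrefl not_le)
      note ge = gamma_system_veblen_ge[OF \<nu>(1-3), of \<zeta>, folded \<nu>(4), OF less.prems(1)]
      show ?thesis
      proof (cases "\<theta> = 0")
        case True
        then have "\<nu> \<noteq> ?g"
          using less.prems(2) \<nu>(4) by auto
        with \<open>?g \<le> \<nu>\<close> \<nu> True less have "?g \<le> gamma_system \<zeta> X \<nu> n"
          by simp
        \<comment> \<open>One application suffices because \<open>veblen ?g 0\<close> is
          \<open>?g\<close> again.\<close>
        with ge(1)[of ?g X n 1 0] have "veblen ?g 0 \<le> gamma_system \<zeta> X \<eta> n"
          by simp
        then show ?thesis
          by simp
      next
        case False
        then have "veblen \<nu> 0 + 1 \<le> gamma_system \<zeta> X \<eta> n"
          by (intro ge(2)) (simp_all add: ordinal_pos_iff)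
        with \<open>?g \<le> \<nu>\<close> show ?thesis
          by (meson le_veblen_zero less_imp_le order_trans ordinal_succ_le_iff)
      qed
    qed
  qed
  then show ?thesis
    by (simp add: barrier_def)
qed

text \<open>The same division as in \<open>barrier_Gamma\<close>; the extra unit comes from a second
  application of the function or from the successor in the start.\<close>

lemma barrier_Gamma_succ:
  assumes "fundamental_system \<zeta> X" "1 < n"
  shows "barrier \<zeta> X n (\<lambda>x. veblen x 0) (Gamma \<xi> + 1)"
  unfolding barrier_def
proof (intro allI impI)
  let ?g = "Gamma \<xi>"
  fix \<eta> assume \<eta>: "\<eta> \<le> Gamma \<zeta>" "?g + 1 < \<eta>" "\<eta> < veblen \<eta> 0"
  have "?g < \<eta>"
    using \<eta>(2) by (meson less_trans ordinal_less_succ_iff order_refl)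
  show "?g + 1 \<le> gamma_system \<zeta> X \<eta> n"
  proof (cases "\<exists>i<?g. \<eta> < veblen i \<eta>")
    case True
    then show ?thesis
      using barrier_fixed_point_succ[OF assms veblen_Gamma] \<eta> barrierD by metis
  next
    case False
    then have fixed: "veblen i \<eta> = \<eta>" if "i < ?g" for i
      using that less_veblen_iff by blast
    with Gamma_pos have "omega_pow \<eta> = \<eta>"
      using veblen_zero_left by metis
    from this \<eta>(3) obtain \<nu> \<theta> where \<nu>: "0 < \<nu>" "\<nu> < veblen \<nu> \<theta>" "\<theta> < veblen \<nu> \<theta>"
        "\<eta> = veblen \<nu> \<theta>" "\<And>i. veblen i \<eta> = \<eta> \<Longrightarrow> i < \<nu>"
      by (rule fixed_point_cases) blast
    have "?g \<le> \<nu>"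
      using fixed \<nu>(5) by (meson less_irrefl not_le)
    note ge = gamma_system_veblen_ge[OF \<nu>(1-3), of \<zeta>, folded \<nu>(4), OF \<eta>(1)]
    show ?thesis
    proof (cases "\<theta> = 0")
      case True
      then have "\<nu> \<noteq> ?g"
        using \<open>?g < \<eta>\<close> \<nu>(4) by auto
      with \<open>?g \<le> \<nu>\<close> have "?g < \<nu>"
        by simp
      then have "?g \<le> gamma_system \<zeta> X \<nu> n"
        using assms(2) \<nu> True \<eta>(1) by (intro barrierD[OF barrier_Gamma]) simp_all
      \<comment> \<open>The first application leads from 0 only to \<open>?g\<close>; the second, at
        a positive argument, exceeds the index \<open>?g\<close>.\<close>
      with ge(1)[of ?g X n 2 0] have "veblen ?g ?g \<le> gamma_system \<zeta> X \<eta> n"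
        using assms(2) by (simp add: numeral_2_eq_2)
      moreover have "?g < veblen ?g ?g"
        by (rule left_less_veblen) simp
      ultimately show ?thesis
        by simp
    next
      case False
      then have "veblen \<nu> 0 + 1 \<le> gamma_system \<zeta> X \<eta> n"
        by (intro ge(2)) (simp_all add: ordinal_pos_iff)
      with \<open>?g \<le> \<nu>\<close> show ?thesis
        by (meson le_veblen_zero le_less_trans ordinal_succ_le_iff)
    qed
  qed
qed

text \<open>The counterpart of \<open>barrier_veblen\<close> when the index itself is iterated. An
  \<eta> fixed by \<open>veblen b\<close> has outermost index \<nu> > b, and for argument 0 the
  assumption on b is applied to \<nu>.\<close>

lemma barrier_veblen_zero:
  assumes "0 < n" "barrier \<zeta> X n (\<lambda>x. veblen x 0) b"
  shows "barrier \<zeta> X n (\<lambda>x. veblen x 0) (veblen b 0)"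
  unfolding barrier_def
proof (intro allI impI)
  fix \<eta> assume \<eta>: "\<eta> \<le> Gamma \<zeta>" "veblen b 0 < \<eta>" "\<eta> < veblen \<eta> 0"
  show "veblen b 0 \<le> gamma_system \<zeta> X \<eta> n"
  proof (cases "\<eta> < veblen b \<eta>")
    case True
    with \<eta> show ?thesis
      \<comment> \<open>The ordinal 0 is trivially a barrier for \<open>veblen b\<close>, hence so
        is \<open>veblen b 0\<close>.\<close>
      by (intro barrierD[OF barrier_veblen[OF assms(1) barrier_zero]])
  next
    case False
    then have fixed: "veblen b \<eta> = \<eta>"
      using less_veblen_iff by blast
    from veblen_fixed_omega_pow[OF this] \<eta>(3) obtain \<nu> \<theta> where \<nu>: "0 < \<nu>" "\<nu> < veblen \<nu> \<theta>"
        "\<theta> < veblen \<nu> \<theta>" "\<eta> = veblen \<nu> \<theta>" "\<And>i. veblen i \<eta> = \<eta> \<Longrightarrow> i < \<nu>"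
      by (rule fixed_point_cases) blast
    have "b < \<nu>"
      by (rule \<nu>(5)[OF fixed])
    note ge = gamma_system_veblen_ge[OF \<nu>(1-3), of \<zeta>, folded \<nu>(4), OF \<eta>(1)]
    show ?thesis
    proof (cases "\<theta> = 0")
      case True
      with \<nu> \<eta>(1) \<open>b < \<nu>\<close> have "b \<le> gamma_system \<zeta> X \<nu> n"
        by (intro barrierD[OF assms(2)]) simp_all
      with ge(1)[of b X n 1 0] show ?thesis
        by simp
    next
      case False
      then have "veblen \<nu> 0 + 1 \<le> gamma_system \<zeta> X \<eta> n"
        by (intro ge(2)) (simp_all add: ordinal_pos_iff)
      moreover have "veblen b 0 \<le> veblen \<nu> 0"
        using \<open>b < \<nu>\<close> by simp
      ultimately show ?thesis
        by (meson less_imp_le order_trans ordinal_succ_le_iff)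
    qed
  qed
qed

section \<open>Comparison of two ordinals by their shapes\<close>

lemma gamma_system_nested:
  assumes X: "fundamental_system \<zeta> X" "nested \<zeta> X" and "1 < n"
  shows "\<beta> \<le> Gamma \<zeta> \<Longrightarrow> gamma_system \<zeta> X \<beta> n < \<gamma> \<Longrightarrow> \<gamma> < \<beta> \<Longrightarrow>
    gamma_system \<zeta> X \<beta> n \<le> gamma_system \<zeta> X \<gamma> n"
proof (induction \<beta> arbitrary: \<gamma> rule: less_induct)
  case (less \<beta>)
  let ?F = "\<lambda>\<alpha>. gamma_system \<zeta> X \<alpha> n"
  have "0 < n"
    using assms(3) by simp
  have "0 < \<gamma>" "0 < \<beta>" "\<gamma> \<le> Gamma \<zeta>"
    using less.prems le_less_trans[OF ordinal_zero_le] by (auto simp: less_imp_le)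
  have F_less: "?F \<alpha> < \<alpha>" if "0 < \<alpha>" "\<alpha> \<le> Gamma \<zeta>" for \<alpha>
    using fundamental_systemD(2)[OF fundamental_system_gamma_system[OF X(1)]] that by blast
  have IH: "?F \<alpha> \<le> ?F \<eta>" if "\<alpha> < \<beta>" "?F \<alpha> < \<eta>" "\<eta> < \<alpha>" for \<alpha> \<eta>
    using less.IH[of \<alpha> \<eta>] less.prems(1) that by simp
  from \<open>0 < \<beta>\<close> show ?case
  proof (cases rule: ordinal_shape_cases)
    case (sum \<tau> a)
    have eq: "?F \<beta> = \<tau> + ?F (omega_pow a)"
      using less.prems(1) sum by (simp add: gamma_system_sum)
    then have "\<tau> \<le> \<gamma>"
      using less.prems(2) by (metis le_less_trans less_imp_le ordinal_le_add_left)
    from ordinal_le_obtain_add[OF this] obtain \<rho> where \<rho>: "\<gamma> = \<tau> + \<rho>" .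
    have less_\<rho>: "?F (omega_pow a) < \<rho>" and "\<rho> < omega_pow a"
      using less.prems(2,3) eq by (simp_all add: \<rho> sum(3))
    have "omega_pow a < \<beta>"
      using exponents_ge_omega_pow_le[OF sum(2,1)] by (simp add: sum(3) le_less_trans)
    then have "?F (omega_pow a) \<le> ?F \<rho>"
      using less_\<rho> \<open>\<rho> < omega_pow a\<close> by (rule IH)
    moreover have "?F \<gamma> = \<tau> + ?F \<rho>"
      unfolding \<rho> using sum(1,2) le_less_trans[OF ordinal_zero_le less_\<rho>] \<open>\<rho> < omega_pow a\<close>
      by (rule gamma_system_add) (use \<open>\<gamma> \<le> Gamma \<zeta>\<close> \<rho> in simp)
    ultimately show ?thesis
      by (simp add: eq)
  next
    case one
    with less.prems \<open>0 < \<gamma>\<close> show ?thesis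
      by simp
  next
    case (omega_pow a)
    let ?e = "?F a"
    have eq: "?F \<beta> = omega_pow ?e * ord_of_nat n"
      using less.prems(1) omega_pow by (simp add: gamma_system_omega_pow)
    then have e_le: "omega_pow ?e \<le> ?F \<beta>"
      using ordinal_le_mult_ord_of_nat[OF \<open>0 < n\<close>, of "omega_pow ?e"] by simp
    show ?thesis
    proof (cases "omega_pow \<gamma> = \<gamma>")
      case True
      then have "\<gamma> < a"
        using less.prems(3) by (metis omega_pow(3) omega_pow_less_iff)
      \<comment> \<open>A fixed point of \<open>omega_pow\<close> below the exponent is a barrier
        for it; this puts \<gamma> below \<beta>[n], so the case cannot occur.\<close>
      then have "\<gamma> \<le> ?e"
        using barrierD[OF barrier_fixed_point[OF \<open>0 < n\<close>, of 0 \<gamma>]] True omega_pow less.prems(1)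
        by (simp add: veblen_zero_left)
      also have "\<dots> \<le> omega_pow ?e"
        using strict_mono_ordinal_le[OF strict_mono_omega_pow] .
      also have "\<dots> \<le> ?F \<beta>"
        by (rule e_le)
      finally show ?thesis
        using less.prems(2) by simp
    next
      case False
      from \<open>0 < \<gamma>\<close> show ?thesis
      proof (cases rule: ordinal_shape_cases)
        case (sum \<tau> c)
        then have "?F \<beta> \<le> \<tau>"
          using less.prems(2) unfolding eq by (intro omega_pow_mult_le_head) simp_all
        then show ?thesis
          using sum \<open>\<gamma> \<le> Gamma \<zeta>\<close> by (metis gamma_system_sum ordinal_le_add_left order_trans)
      next
        case one
        with less.prems(2) e_le omega_pow_pos(1)[of ?e] show ?thesis
          by simp
      next
        case (omega_pow c)
        have "omega_pow ?e < omega_pow c" "omega_pow c < omega_pow a"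
          using le_less_trans[OF e_le less.prems(2)] less.prems(3) \<open>\<beta> = omega_pow a\<close> omega_pow(3) by simp_all
        \<comment> \<open>The exponents stand in the same relation as \<beta> and \<gamma>:
          \<open>?e\<close> < c < a.\<close>
        then have "?e \<le> ?F c"
          using \<open>a < omega_pow a\<close> \<open>\<beta> = omega_pow a\<close> by (intro IH) simp_all
        moreover have "?F \<gamma> = omega_pow (?F c) * ord_of_nat n"
          using \<open>\<gamma> \<le> Gamma \<zeta>\<close> omega_pow by (simp add: gamma_system_omega_pow)
        ultimately show ?thesis
          by (simp add: eq ordinal_mult_ord_of_nat_mono)
      next
        case (veblen \<delta> \<alpha>)
        with False show ?thesis
          by (simp add: omega_pow_veblen)
      next
        case (Gamma \<xi>)
        with False show ?thesis
          by (simp add: Gamma_eq_omega_pow)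
      qed
    qed
  next
    case (veblen \<delta> \<alpha>)
    let ?D = "?F \<delta>" and ?x = "veblen \<delta> (?F \<alpha>)" and ?b = "veblen_base \<delta> \<alpha> (?F \<alpha>)"
    have \<beta>_le: "veblen \<delta> \<alpha> \<le> Gamma \<zeta>"
      using less.prems(1) veblen(4) by simp
    have eq: "?F \<beta> = (veblen ?D ^^ (n + 1)) ?b"
      unfolding veblen(4) using veblen(1-3) \<beta>_le by (rule gamma_system_veblen_eq)
    have x_less: "?x < \<gamma>" if "0 < \<alpha>"
    proof -
      have "?x + 1 \<le> ?F \<beta>"
        unfolding veblen(4) by (rule gamma_system_veblen_ge(2)[OF veblen(1-3) \<beta>_le that order_refl])
      with less.prems(2) show ?thesis
        by simp
    qed
    have D: "?D < \<delta>"
      using veblen \<beta>_le by (intro F_less) simp_all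
    have "barrier \<zeta> X n (veblen ?D) ?b"
      using barrier_fixed_point_succ[OF X(1) assms(3) veblen_veblen[OF D]]
      by (simp add: veblen_base_def barrier_zero)
    then have barrier: "barrier \<zeta> X n (veblen ?D) (?F \<beta>)"
      unfolding eq by (intro barrier_funpow barrier_veblen \<open>0 < n\<close>)
    show ?thesis
    proof (cases "\<gamma> < veblen ?D \<gamma>")
      case True
      with barrier less.prems(2) \<open>\<gamma> \<le> Gamma \<zeta>\<close> show ?thesis
        by (intro barrierD)
    next
      case False
      then have D_fixed: "veblen ?D \<gamma> = \<gamma>"
        using less_veblen_iff by blast
      have D_le: "?D \<le> ?F \<beta>"
        by (simp add: eq)
      \<comment> \<open>Otherwise \<gamma> would be a barrier below the argument \<alpha>, hence at
        most \<alpha>[n], although the start of the iteration already lies below \<gamma>.\<close>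
      have not_fixed: "veblen \<delta> \<gamma> \<noteq> \<gamma>"
      proof
        assume fixed: "veblen \<delta> \<gamma> = \<gamma>"
        then have "\<gamma> < \<alpha>"
          using less.prems(3) by (metis veblen(4) veblen_less_iff)
        then have "\<gamma> \<le> ?F \<alpha>"
          using veblen(3) \<beta>_le by (intro barrierD[OF barrier_fixed_point[OF \<open>0 < n\<close> fixed]]) simp_all
        also have "\<dots> \<le> ?x"
          by simp
        also have "\<dots> < \<gamma>"
          using \<open>\<gamma> < \<alpha>\<close> by (intro x_less) (rule le_less_trans[OF ordinal_zero_le])
        finally show False
          by simp
      qed
      from veblen_fixed_omega_pow[OF D_fixed] show ?thesis
      proof (cases rule: omega_pow_fixed_cases)
        case (1 \<mu> \<eta>)
        \<comment> \<open>Both members are (n+1)-fold iterates, so it is enough to compare the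
          indices and the starts.\<close>
        have \<gamma>_ge: "(veblen \<nu> ^^ (n + 1)) b \<le> ?F \<gamma>"
          if "\<nu> \<le> ?F \<mu>" "b \<le> veblen_base \<mu> \<eta> (?F \<eta>)" for \<nu> b
          unfolding 1(4) using 1 \<open>\<gamma> \<le> Gamma \<zeta>\<close> that by (intro gamma_system_veblen_ge(1)) simp_all
        have "?D < \<mu>"
          using D_fixed 1(3,4) veblen_fixed_antimono[of ?D \<gamma> \<mu>]
          by (metis less_irrefl not_le veblen_eq_iff)
        have "\<mu> \<le> \<delta>"
          using not_fixed 1(4) veblen_veblen not_le by blast
        show ?thesis
        proof (cases "\<mu> = \<delta>")
          case True
          \<comment> \<open>With equal outermost indices the arguments satisfy \<alpha>[n] < \<eta>
            < \<alpha>, and the induction hypothesis for \<alpha> compares the starts.\<close>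
          then have "\<eta> < \<alpha>"
            using less.prems(3) 1(4) veblen(4) by simp
          then have "0 < \<alpha>"
            by (rule le_less_trans[OF ordinal_zero_le])
          from x_less[OF this] have "?F \<alpha> < \<eta>"
            using True 1(4) by simp
          then have "?F \<alpha> \<le> ?F \<eta>" "0 < \<eta>"
            using IH[of \<alpha> \<eta>] \<open>\<eta> < \<alpha>\<close> veblen(3,4) le_less_trans[OF ordinal_zero_le, of "?F \<alpha>" \<eta>] by simp_all
          with \<open>0 < \<alpha>\<close> True show ?thesis
            unfolding eq by (intro \<gamma>_ge) (simp_all add: ordinal_add_mono_left del: ordinal_succ_le_iff)
        next
          case False
          with \<open>\<mu> \<le> \<delta>\<close> have "\<mu> < \<delta>"
            by simp
          \<comment> \<open>Here \<delta>[n] < \<mu> < \<delta>, so the induction hypothesis for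
            \<delta> compares the indices.\<close>
          have "?D \<le> ?F \<mu>"
            using \<open>?D < \<mu>\<close> \<open>\<mu> < \<delta>\<close> veblen(2,4) by (intro IH) simp_all
          moreover have "?b \<le> veblen_base \<mu> \<eta> (?F \<eta>)"
          proof (cases "\<alpha> = 0")
            case True
            then show ?thesis
              by simp
          next
            case False
            then have "0 < \<alpha>"
              by (simp add: ordinal_pos_iff)
            \<comment> \<open>Since \<mu> < \<delta>, the value \<open>?x\<close> is a fixed point
              of \<open>veblen \<mu>\<close> and therefore a barrier for \<eta>; this compares the
              starts although the arguments \<alpha> and \<eta> are unrelated.\<close>
            have x_fixed: "veblen \<mu> ?x = ?x"
              using \<open>\<mu> < \<delta>\<close> by (rule veblen_veblen)
            then have "?x < \<eta>"
              using x_less[OF \<open>0 < \<alpha>\<close>] 1(4) by (metis veblen_less_iff)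
            then have "?x \<le> ?F \<eta>"
              using 1 \<open>\<gamma> \<le> Gamma \<zeta>\<close>
              by (intro barrierD[OF barrier_fixed_point[OF \<open>0 < n\<close> x_fixed]]) simp_all
            also have "\<dots> \<le> veblen \<mu> (?F \<eta>)"
              by simp
            finally have "?x \<le> veblen \<mu> (?F \<eta>)" .
            moreover have "0 < \<eta>"
              using \<open>?x < \<eta>\<close> by (rule le_less_trans[OF ordinal_zero_le])
            ultimately show ?thesis
              using \<open>0 < \<alpha>\<close> by (simp add: ordinal_add_mono_left del: ordinal_succ_le_iff)
          qed
          ultimately show ?thesis
            unfolding eq by (rule \<gamma>_ge)
        qed
      next
        case (2 \<xi>)
        have "\<gamma> \<le> \<delta>"
          using not_fixed 2 veblen_Gamma not_le by blast
        have "\<alpha> = 0"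
        proof (rule ccontr)
          assume "\<alpha> \<noteq> 0"
          then have "?x < \<gamma>"
            by (intro x_less) (simp add: ordinal_pos_iff)
          with \<open>\<gamma> \<le> \<delta>\<close> left_le_veblen[of \<delta> "?F \<alpha>"] show False
            by (meson leD order_trans)
        qed
        have "\<gamma> \<noteq> \<delta>"
          using veblen(2) 2 \<open>\<alpha> = 0\<close> by auto
        \<comment> \<open>A \<open>Gamma \<xi>\<close> below \<delta> is a barrier for \<delta>, so
          it is at most \<delta>[n] and hence at most \<beta>[n], against the choice of
          \<gamma>.\<close>
        with \<open>\<gamma> \<le> \<delta>\<close> veblen(2) \<beta>_le have "\<gamma> \<le> ?D"
          unfolding 2 \<open>\<alpha> = 0\<close> by (intro barrierD[OF barrier_Gamma[OF \<open>0 < n\<close>]]) simp_all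
        with D_le less.prems(2) show ?thesis
          by simp
      qed
    qed
  next
    case (Gamma \<xi>)
    with less.prems(1) have "\<xi> \<le> \<zeta>"
      by simp
    let ?h = "\<lambda>x. veblen x (0 :: 'a ordinal)"
    define b where "b = (if \<xi> = 0 then 0 else Gamma (X \<xi> n) + 1)"
    have eq: "?F \<beta> = (?h ^^ (n + 1)) b"
      using \<open>\<xi> \<le> \<zeta>\<close> unfolding Gamma b_def
      by (auto simp: gamma_system_Gamma_zero gamma_system_Gamma ordinal_pos_iff)
    have "barrier \<zeta> X n ?h b"
      using barrier_Gamma_succ[OF X(1) assms(3)] by (simp add: b_def barrier_zero)
    then have barrier: "barrier \<zeta> X n ?h (?F \<beta>)"
      unfolding eq by (intro barrier_funpow barrier_veblen_zero \<open>0 < n\<close>)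
    show ?thesis
    proof (cases "\<gamma> < veblen \<gamma> 0")
      case True
      with barrier less.prems(2) \<open>\<gamma> \<le> Gamma \<zeta>\<close> show ?thesis
        by (intro barrierD)
    next
      case False
      then obtain \<theta> where \<theta>: "\<gamma> = Gamma \<theta>"
        using less_veblen_zero_iff by blast
      have "\<theta> < \<xi>"
        using less.prems(3) \<theta> Gamma by simp
      then have "0 < \<xi>"
        by (rule le_less_trans[OF ordinal_zero_le])
      have "b \<le> ?F \<beta>"
        unfolding eq using funpow_veblen_zero_le[of b b 0 "n + 1"] by simp
      also have "\<dots> < Gamma \<theta>"
        using less.prems(2) \<theta> by simp
      finally have "Gamma (X \<xi> n) + 1 < Gamma \<theta>"
        using \<open>0 < \<xi>\<close> by (simp add: b_def ordinal_pos_iff)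
      then have "X \<xi> n < \<theta>"
        by (meson Gamma_less_iff less_trans ordinal_less_succ_iff order_refl)
      \<comment> \<open>Since \<open>X \<xi> n\<close> < \<theta> < \<xi>, this is precisely the
        nestedness of the given system; it orders the starts of two iterations of the same
        function.\<close>
      then have "X \<xi> n \<le> X \<theta> n"
        using X(2) \<open>\<theta> < \<xi>\<close> \<open>\<xi> \<le> \<zeta>\<close> assms(3) unfolding nested_def by (meson not_le)
      moreover have "0 < \<theta>"
        using \<open>X \<xi> n < \<theta>\<close> by (rule le_less_trans[OF ordinal_zero_le])
      ultimately show ?thesis
        unfolding eq \<theta> using \<open>0 < \<xi>\<close> \<open>\<theta> < \<xi>\<close> \<open>\<xi> \<le> \<zeta>\<close>
        by (subst gamma_system_Gamma)
          (auto simp: b_def ordinal_add_mono_left simp del: funpow.simps ordinal_succ_le_iff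
            intro!: funpow_veblen_zero_le)
    qed
  qed
qed

theorem theorem2p16:
  fixes \<zeta> :: "'a ordinal"
    and X :: "'a ordinal \<Rightarrow> nat \<Rightarrow> 'a ordinal"
  assumes "fundamental_system \<zeta> X"
    and "nested \<zeta> X"
  shows "fundamental_system (Gamma \<zeta>) (gamma_system \<zeta> X) \<and>
         nested (Gamma \<zeta>) (gamma_system \<zeta> X)"
proof
  show "fundamental_system (Gamma \<zeta>) (gamma_system \<zeta> X)"
    using assms(1) by (rule fundamental_system_gamma_system)
  show "nested (Gamma \<zeta>) (gamma_system \<zeta> X)"
    unfolding nested_def using gamma_system_nested[OF assms] not_le by blast
qed

end
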